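(* Assume $\mathrm{Rank}(\mathbf{X}) \geq d$. Define $$\tau=\sum_{i=1}^p \Big(\frac{\lambda_i}{\eta_i} \Big)^2 .$$ Then the mean squared error of the (limiting) averaged compressed least squares estimator $\hat{\beta}_d$ satisfies $$\mathbb{E}_{\phi}\big[\mathbb{E}_{\varepsilon}[\|\mathbf{X} \beta-\mathbf{X}\hat{\beta}_d \|_2^2]\big]\leq\sigma^2 \tau+\sum_{i=1}^p \beta_i^2 \lambda_i w_i^2,$$ where, for $i=1,\dots,p$, $$w_i = \frac{(1+1/d)\lambda_i^2+(1+2/d)\lambda_i \operatorname{trace}(\Sigma)+\operatorname{trace}(\Sigma)^2/d}{(d+2+1/d)\lambda_i^2+2(1+1/d)\lambda_i \operatorname{trace}(\Sigma)+\operatorname{trace}(\Sigma)^2/d},$$ and $$\tau \in [d^2/p,\,d].$$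
   Context: Fixed design linear model: $\mathbf{X}\in\mathbb{R}^{n\times p}$ is a deterministic matrix, $\beta\in\mathbb{R}^p$ a fixed vector, and $\mathbf{Y}=\mathbf{X}\beta+\varepsilon$, where $\varepsilon\in\mathbb{R}^n$ is i.i.d. noise with $\mathbb{E}_\varepsilon[\varepsilon]=0$ and $\mathbb{E}_\varepsilon[\varepsilon\varepsilon']=\sigma^2 I_{n\times n}$. The coordinates are chosen so that the Gram matrix is diagonal: $\Sigma=\mathbf{X}'\mathbf{X}=\mathrm{diag}(\lambda_1,\dots,\lambda_p)$. Here $d\ge 1$ is an integer. A random projection is a random matrix $\phi\in\mathbb{R}^{p\times d}$ with i.i.d. $\mathcal{N}(0,1/d)$ entries, independent of $\varepsilon$. For a random projection $\phi$ the compressed least squares estimator is $$\hat{\beta}_d^{\phi}=\phi\,\operatorname{argmin}_{\gamma\in\mathbb{R}^d}\|\mathbf{Y}-\mathbf{X}\phi\gamma\|_2^2 = \phi(\phi'\mathbf{X}'\mathbf{X}\phi)^{-1}\phi'\mathbf{X}'\mathbf{Y}$$ (under the rank hypothesis, $\phi'\mathbf{X}'\mathbf{X}\phi$ is invertible almost surely). For independent random projections $\phi_1,\phi_2,\dots$, the averaged compressed least squares estimator is $\hat{\beta}_d^K=\frac1K\sum_{i=1}^K\hat{\beta}_d^{\phi_i}$, and $\hat{\beta}_d=\lim_{K\to\infty}\hat{\beta}_d^K$. Only $\mathbf{X}\hat{\beta}_d$ matters, and it is understood as the almost sure limit $\lim_{K\to\infty}\mathbf{X}\hat{\beta}_d^K$.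 Define $\phi_d^{\mathbf{X}}=\phi(\phi'\mathbf{X}'\mathbf{X}\phi)^{-1}\phi'\in\mathbb{R}^{p\times p}$ and $T_d^{\phi}=\mathbb{E}_\phi[\phi_d^{\mathbf{X}}]$. Since $\Sigma$ is diagonal, $T_d^{\phi}$ is diagonal, and the $\eta_i$ are defined by $T_d^{\phi}=\mathrm{diag}(1/\eta_1,\dots,1/\eta_p)$. The ratio $\lambda_i/\eta_i$ means $\mathbb{E}_\phi[\lambda_i(\phi_d^{\mathbf{X}})_{ii}]$; in particular it is $0$ when $\lambda_i=0$. $\mathbb{E}_\phi$ and $\mathbb{E}_\varepsilon$ denote expectation over the random projection(s) and over $\varepsilon$ respectively, and a prime denotes transpose. *)

theory Defs
  imports "HOL-Probability.Probability"
begin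

text \<open>
  A matrix with \<open>n\<close> rows and \<open>p\<close> columns has type \<^typ>\<open>real^'p^'n\<close>, so the design matrix is
  \<open>X :: real^'p^'n\<close>, a projection is \<open>\<phi> :: real^'d^'p\<close>, and \<open>d\<close> is \<open>CARD('d)\<close>.
\<close>

definition diag_matrix :: "('p \<Rightarrow> real) \<Rightarrow> real^'p^'p"
  where "diag_matrix a = (\<chi> i j. if i = j then a i else 0)"

text \<open>\<^const>\<open>normal_density\<close> takes the standard deviation, so variance \<open>1 / d\<close> is \<open>1 / sqrt d\<close>.\<close>

definition random_projection :: "'w measure \<Rightarrow> ('w \<Rightarrow> real^'d^'p) \<Rightarrow> bool"
  where "random_projection M \<phi> \<longleftrightarrow>
    prob_space.indep_vars M (\<lambda>_. borel) (\<lambda>(i, j) \<omega>. \<phi> \<omega> $ i $ j) UNIV \<and>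
    (\<forall>i j. distributed M lborel (\<lambda>\<omega>. \<phi> \<omega> $ i $ j)
             (normal_density 0 (1 / sqrt (real CARD('d)))))"

text \<open>
  The library predicate \<open>indep_var\<close> requires both random variables to have the same type.
\<close>

definition independent_rvs ::
    "'w measure \<Rightarrow> 'a measure \<Rightarrow> ('w \<Rightarrow> 'a) \<Rightarrow> 'b measure \<Rightarrow> ('w \<Rightarrow> 'b) \<Rightarrow> bool"
  where "independent_rvs M A U B V \<longleftrightarrow>
    U \<in> measurable M A \<and> V \<in> measurable M B \<and>
    prob_space.indep_set M (sets (vimage_algebra (space M) U A)) (sets (vimage_algebra (space M) V B))"

definition iid_noise :: "'w measure \<Rightarrow> real \<Rightarrow> ('w \<Rightarrow> real^'n) \<Rightarrow> bool"
  where "iid_noise M \<sigma> \<epsilon> \<longleftrightarrow>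
    prob_space.indep_vars M (\<lambda>_. borel) (\<lambda>i \<omega>. \<epsilon> \<omega> $ i) UNIV \<and>
    (\<forall>i j. distr M borel (\<lambda>\<omega>. \<epsilon> \<omega> $ i) = distr M borel (\<lambda>\<omega>. \<epsilon> \<omega> $ j)) \<and>
    has_bochner_integral M \<epsilon> 0 \<and>
    has_bochner_integral M (\<lambda>\<omega>. \<chi> i j. \<epsilon> \<omega> $ i * \<epsilon> \<omega> $ j) (mat (\<sigma>\<^sup>2))"

definition compressed_ls :: "real^'p^'n \<Rightarrow> real^'d^'p \<Rightarrow> real^'n \<Rightarrow> real^'p"
  where "compressed_ls X \<phi> Y = \<phi> *v arg_min (\<lambda>\<gamma>. (norm (Y - X *v (\<phi> *v \<gamma>)))\<^sup>2) (\<lambda>_. True)"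

text \<open>The first projection has index \<open>0\<close>.\<close>

definition averaged_compressed_ls ::
    "real^'p^'n \<Rightarrow> (nat \<Rightarrow> real^'d^'p) \<Rightarrow> nat \<Rightarrow> real^'n \<Rightarrow> real^'p"
  where "averaged_compressed_ls X \<phi> K Y = (1 / real K) *\<^sub>R (\<Sum>k<K. compressed_ls X (\<phi> k) Y)"

text \<open>
  The limit is taken of the fitted values: if \<open>X\<close> has a zero column, the corresponding
  coordinate of the averaged estimator itself need not converge.
\<close>

definition limit_fit :: "real^'p^'n \<Rightarrow> (nat \<Rightarrow> real^'d^'p) \<Rightarrow> real^'n \<Rightarrow> real^'n"
  where "limit_fit X \<phi> Y = lim (\<lambda>K. X *v averaged_compressed_ls X \<phi> K Y)"

definition phi_X :: "real^'p^'n \<Rightarrow> real^'d^'p \<Rightarrow> real^'p^'p"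
  where "phi_X X \<phi> = \<phi> ** matrix_inv (transpose \<phi> ** transpose X ** X ** \<phi>) ** transpose \<phi>"

text \<open>
  This is \<open>\<lambda>\<^sub>i / \<eta>\<^sub>i\<close>. The factor \<open>\<lambda>\<^sub>i\<close> stays under the integral because the diagonal entry
  alone need not be integrable when \<open>\<lambda>\<^sub>i = 0\<close>.
\<close>

definition eigen_ratio ::
    "'w measure \<Rightarrow> real^'p^'n \<Rightarrow> ('w \<Rightarrow> real^'d^'p) \<Rightarrow> ('p \<Rightarrow> real) \<Rightarrow> 'p \<Rightarrow> real"
  where "eigen_ratio M X \<phi> lam i = (LINT \<omega>|M. lam i * phi_X X (\<phi> \<omega>) $ i $ i)"

text \<open>
  \<open>\<Phi>\<close> is the sequence of projections. The expectations over projections and over noise are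
  integrals against the law of \<open>\<Phi>\<close> on sequence space and the law of \<open>\<epsilon>\<close>. They are taken as
  nonnegative integrals, so that a finite bound includes integrability.
\<close>

definition limit_mse ::
    "'w measure \<Rightarrow> real^'p^'n \<Rightarrow> real^'p \<Rightarrow> (nat \<Rightarrow> 'w \<Rightarrow> real^'d^'p) \<Rightarrow> ('w \<Rightarrow> real^'n) \<Rightarrow> ennreal"
  where "limit_mse M X \<beta> \<Phi> \<epsilon> =
    (\<integral>\<^sup>+ \<phi>. (\<integral>\<^sup>+ e. ennreal ((norm (X *v \<beta> - limit_fit X \<phi> (X *v \<beta> + e)))\<^sup>2)
          \<partial>distr M borel \<epsilon>)
      \<partial>distr M (PiM UNIV (\<lambda>_. borel)) (\<lambda>\<omega> k. \<Phi> k \<omega>))"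

definition bias_weight :: "real \<Rightarrow> real \<Rightarrow> real \<Rightarrow> real"
  where "bias_weight d tr l =
    ((1 + 1 / d) * l\<^sup>2 + (1 + 2 / d) * l * tr + tr\<^sup>2 / d) /
    ((d + 2 + 1 / d) * l\<^sup>2 + 2 * (1 + 1 / d) * l * tr + tr\<^sup>2 / d)"

end

theory Submission
  imports Defs
begin

text \<open>
  The matrix \<open>P = X (phi_X X \<phi>) X\<^sup>T\<close> is almost surely the orthogonal projection onto the
  \<open>d\<close>-dimensional range of \<open>X \<phi>\<close>, so its entries are bounded and the strong law turns the averaged
  fit into \<open>E[P] Y\<close>. The law of \<open>\<phi>\<close> does not change when a row of \<open>\<phi>\<close> is negated, hence \<open>E[P]\<close>
  is diagonal in the basis of normalised columns of \<open>X\<close>, with diagonal entries \<open>h\<^sub>i = \<lambda>\<^sub>i / \<eta>\<^sub>i\<close>.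
  The mean squared error is therefore exactly
  \<open>\<sigma>\<^sup>2 \<Sum>\<^sub>i h\<^sub>i\<^sup>2 + \<Sum>\<^sub>i \<beta>\<^sub>i\<^sup>2 \<lambda>\<^sub>i (1 - h\<^sub>i)\<^sup>2\<close>. As \<open>0 \<le> h\<^sub>i \<le> 1\<close> and \<open>\<Sum>\<^sub>i h\<^sub>i = trace P = d\<close>, the bounds on
  \<open>\<tau>\<close> follow. Finally \<open>1 - h\<^sub>i\<close> is the expected squared distance from the \<open>i\<close>-th normalised column
  to the range of \<open>X \<phi>\<close>; comparing with the multiple \<open>c X \<phi> \<phi>\<^sup>T e\<^sub>i\<close> for the best constant \<open>c\<close>
  and using the second and fourth Gaussian moments gives \<open>1 - h\<^sub>i \<le> w\<^sub>i\<close>.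
\<close>

subsection \<open>Linear algebra of compressed least squares\<close>

text \<open>The Gram matrix of \<open>X ** \<phi>\<close>, bracketed exactly as inside
  \<open>phi_X\<close> so that it folds there. That its determinant is nonzero is the nondegeneracy
  condition of the deterministic lemmas below.\<close>

definition compressed_gram :: "real^'p^'n \<Rightarrow> real^'d^'p \<Rightarrow> real^'d^'d"
  where "compressed_gram X \<phi> = transpose \<phi> ** transpose X ** X ** \<phi>"

lemma matrix_inv_inverse:
  fixes A :: "real^'k^'k"
  assumes "det A \<noteq> 0"
  shows "A ** matrix_inv A = mat 1" and "matrix_inv A ** A = mat 1"
proof -
  have "\<exists>C. A ** C = mat 1 \<and> C ** A = mat 1"
    using assms by (auto simp: invertible_def simp flip: invertible_det_nz)
  from someI_ex[OF this] show "A ** matrix_inv A = mat 1" "matrix_inv A ** A = mat 1"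
    by (simp_all add: matrix_inv_def)
qed

lemma diag_matrix_mult_left: "(diag_matrix a ** B) $ i $ j = a i * B $ i $ j"
  by (simp add: matrix_matrix_mult_def diag_matrix_def if_distrib[where f="\<lambda>x. x * _"] cong: if_cong)

lemma det_diag_matrix: "det (diag_matrix a) = (\<Prod>i\<in>UNIV. a i)"
  by (subst det_diagonal) (simp_all add: diag_matrix_def)

lemma diag_matrix_mult_right: "(B ** diag_matrix a) $ i $ j = B $ i $ j * a j"
  by (simp add: matrix_matrix_mult_def diag_matrix_def if_distrib[where f="\<lambda>x. _ * x"] cong: if_cong)

lemma transpose_diag_matrix: "transpose (diag_matrix a) = diag_matrix a"
  by (auto simp: transpose_def diag_matrix_def vec_eq_iff)

lemma transpose_compressed_gram: "transpose (compressed_gram X \<phi>) = compressed_gram X \<phi>"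
  by (simp add: compressed_gram_def matrix_transpose_mul matrix_mul_assoc)

text \<open>The transposed inverse of a symmetric matrix is again an inverse of it, and inverses are
  unique.\<close>

lemma transpose_phi_X:
  fixes \<phi> :: "real^'d^'p"
  assumes "det (compressed_gram X \<phi>) \<noteq> 0"
  shows "transpose (phi_X X \<phi>) = phi_X X \<phi>"
proof -
  let ?A = "compressed_gram X \<phi>"
  let ?C = "matrix_inv ?A"
  note C = matrix_inv_inverse[OF assms]
  have "?A ** transpose ?C = transpose (?C ** ?A)"
    by (simp add: matrix_transpose_mul transpose_compressed_gram)
  then have "?A ** transpose ?C = mat 1" by (simp add: C)
  then have "?C ** (?A ** transpose ?C) = ?C" by simp
  then have "transpose ?C = ?C" by (simp add: matrix_mul_assoc C)
  then show ?thesis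
    by (simp add: phi_X_def matrix_transpose_mul matrix_mul_assoc flip: compressed_gram_def)
qed

text \<open>\<open>phi_X X \<phi> ** (transpose X ** X)\<close> is the projection onto the range of
  \<phi> that is orthogonal for the form of \<open>transpose X ** X\<close>. On that range the
  inverse meets the compressed Gram matrix and cancels.\<close>

lemma phi_X_gram_mult:
  fixes \<phi> :: "real^'d^'p"
  assumes "det (compressed_gram X \<phi>) \<noteq> 0"
  shows "phi_X X \<phi> ** (transpose X ** X) ** \<phi> = \<phi>"
proof -
  have "phi_X X \<phi> ** (transpose X ** X) ** \<phi> = \<phi> ** (matrix_inv (compressed_gram X \<phi>) ** compressed_gram X \<phi>)"
    by (simp add: phi_X_def compressed_gram_def matrix_mul_assoc)
  then show ?thesis by (simp add: matrix_inv_inverse[OF assms])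
qed

lemma phi_X_gram_phi_X:
  fixes \<phi> :: "real^'d^'p"
  assumes "det (compressed_gram X \<phi>) \<noteq> 0"
  shows "phi_X X \<phi> ** (transpose X ** X) ** phi_X X \<phi> = phi_X X \<phi>"
proof -
  have "phi_X X \<phi> ** (transpose X ** X) ** phi_X X \<phi> =
      (phi_X X \<phi> ** (transpose X ** X) ** \<phi>) ** matrix_inv (compressed_gram X \<phi>) ** transpose \<phi>"
    by (simp add: phi_X_def compressed_gram_def matrix_mul_assoc)
  then show ?thesis by (simp only: phi_X_gram_mult[OF assms]) (simp add: phi_X_def compressed_gram_def)
qed

text \<open>The trace of a projection is its rank: cyclicity moves \<open>transpose \<phi>\<close>
  to the front, which leaves the trace of the identity of size d.\<close>

lemma trace_gram_phi_X:
  fixes \<phi> :: "real^'d^'p"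
  assumes "det (compressed_gram X \<phi>) \<noteq> 0"
  shows "trace (transpose X ** X ** phi_X X \<phi>) = real CARD('d)"
proof -
  have "trace (transpose X ** X ** phi_X X \<phi>) =
      trace ((transpose X ** X ** \<phi> ** matrix_inv (compressed_gram X \<phi>)) ** transpose \<phi>)"
    by (simp add: phi_X_def compressed_gram_def matrix_mul_assoc)
  also have "\<dots> = trace (transpose \<phi> ** (transpose X ** X ** \<phi> ** matrix_inv (compressed_gram X \<phi>)))"
    by (rule trace_mul_sym)
  also have "\<dots> = trace (compressed_gram X \<phi> ** matrix_inv (compressed_gram X \<phi>))"
    by (simp add: compressed_gram_def matrix_mul_assoc)
  finally show ?thesis by (simp add: matrix_inv_inverse[OF assms] trace_def mat_def)
qed

section \<open>Entry bounds for a diagonal Gram matrix\<close>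

locale diagonal_gram =
  fixes X :: "real^'p^'n" and lam :: "'p \<Rightarrow> real"
  assumes gram: "transpose X ** X = diag_matrix lam"
begin

lemma column_inner: "column i X \<bullet> column j X = (if i = j then lam i else 0)"
proof -
  have "(transpose X ** X) $ i $ j = column i X \<bullet> column j X"
    by (simp add: matrix_matrix_mult_def transpose_def column_def inner_vec_def)
  then show ?thesis by (simp add: gram diag_matrix_def)
qed

lemma lam_nonneg: "lam i \<ge> 0"
  using column_inner[of i i] inner_ge_zero[of "column i X"] by simp

lemma column_eq_0: "lam i = 0 \<Longrightarrow> column i X = 0"
  using column_inner[of i i] by simp

lemma trace_gram: "trace (transpose X ** X) = sum lam UNIV"
  by (simp add: gram trace_def diag_matrix_def)

lemma norm_mult_vec: "(norm (X *v a))\<^sup>2 = (\<Sum>i\<in>UNIV. lam i * (a $ i)\<^sup>2)"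
proof -
  have "(norm (X *v a))\<^sup>2 = (\<Sum>i\<in>UNIV. a $ i *\<^sub>R column i X) \<bullet> (\<Sum>j\<in>UNIV. a $ j *\<^sub>R column j X)"
    by (simp add: power2_norm_eq_inner matrix_mult_sum scalar_mult_eq_scaleR)
  also have "\<dots> = (\<Sum>i\<in>UNIV. lam i * (a $ i)\<^sup>2)"
    by (simp add: inner_sum_left inner_sum_right column_inner power2_eq_square
        if_distrib cong: if_cong) (simp add: mult_ac)
  finally show ?thesis .
qed

context
  fixes \<phi> :: "real^'d^'p"
  assumes nonsing: "det (compressed_gram X \<phi>) \<noteq> 0"
begin

abbreviation (input) B where "B \<equiv> phi_X X \<phi>"

lemma phi_X_sym: "B $ i $ j = B $ j $ i"
  using arg_cong[OF transpose_phi_X[OF nonsing], of "\<lambda>M. M $ i $ j"] by (simp add: transpose_def)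

text \<open>A diagonal entry of B = B \<Sigma> B with B symmetric and \<Sigma> diagonal. The
  summands are nonnegative, which is the source of the bounds that follow.\<close>

lemma phi_X_diag: "B $ i $ i = (\<Sum>k\<in>UNIV. lam k * (B $ i $ k)\<^sup>2)"
proof -
  have "B = B ** (diag_matrix lam ** B)"
    using phi_X_gram_phi_X[OF nonsing] by (simp add: gram matrix_mul_assoc)
  then have "B $ i $ i = (B ** (diag_matrix lam ** B)) $ i $ i" by simp
  also have "\<dots> = (\<Sum>k\<in>UNIV. B $ i $ k * (lam k * B $ k $ i))"
    by (subst matrix_matrix_mult_def) (simp add: diag_matrix_mult_left)
  also have "\<dots> = (\<Sum>k\<in>UNIV. lam k * (B $ i $ k)\<^sup>2)"
  proof (intro sum.cong refl)
    fix k show "B $ i $ k * (lam k * B $ k $ i) = lam k * (B $ i $ k)\<^sup>2"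
      using phi_X_sym[of k i] by (simp add: power2_eq_square)
  qed
  finally show ?thesis .
qed

lemma phi_X_entry_bound: "lam j * (B $ i $ j)\<^sup>2 \<le> B $ i $ i"
  unfolding phi_X_diag[of i] by (rule member_le_sum) (auto simp: lam_nonneg)

text \<open>The single term \<open>k = i\<close> of \<open>phi_X_diag\<close> gives x^2 \<le> x for
  the scaled entry x, which confines x to the unit interval.\<close>

lemma ratio_bounds: "lam i * B $ i $ i \<in> {0..1}"
proof -
  let ?x = "lam i * B $ i $ i"
  have "?x\<^sup>2 \<le> ?x"
    using mult_left_mono[OF phi_X_entry_bound[of i i] lam_nonneg[of i]]
    by (simp add: power2_eq_square mult_ac)
  moreover have "?x \<ge> 0"
    by (subst phi_X_diag) (auto intro!: mult_nonneg_nonneg sum_nonneg lam_nonneg)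
  moreover have "?x < ?x\<^sup>2" if "?x > 1"
    using that power_strict_increasing[of 1 2 ?x] by simp
  ultimately show ?thesis by force
qed

text \<open>A bound that does not depend on \<phi>, as the strong law needs. Both eigenvalues are
  kept as factors because an entry whose row or column has eigenvalue 0 has no such bound. The
  estimate 2|x| \<le> 1 + x^2 avoids a square root.\<close>

lemma scaled_entry_bound: "\<bar>lam i * lam j * B $ i $ j\<bar> \<le> 1 + lam i * lam j"
proof -
  let ?x = "lam i * lam j * B $ i $ j"
  have "?x\<^sup>2 = (lam i * lam j) * (lam i * (lam j * (B $ i $ j)\<^sup>2))"
    by (simp add: power2_eq_square mult_ac)
  also have "\<dots> \<le> (lam i * lam j) * (lam i * B $ i $ i)"
    by (intro mult_left_mono phi_X_entry_bound mult_nonneg_nonneg lam_nonneg)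
  also have "\<dots> \<le> (lam i * lam j) * 1"
    using ratio_bounds[of i] by (intro mult_left_mono mult_nonneg_nonneg lam_nonneg) auto
  finally have "?x\<^sup>2 \<le> lam i * lam j" by simp
  moreover have "2 * \<bar>?x\<bar> \<le> 1 + ?x\<^sup>2"
    using zero_le_power2[of "\<bar>?x\<bar> - 1"] by (simp add: power2_diff)
  moreover have "0 \<le> lam i * lam j" by (simp add: lam_nonneg)
  ultimately show ?thesis by linarith
qed

lemma sum_ratio: "(\<Sum>i\<in>UNIV. lam i * B $ i $ i) = real CARD('d)"
  using trace_gram_phi_X[OF nonsing] by (simp add: gram trace_def diag_matrix_mult_left)

text \<open>
  Expands \<open>(b - c g)\<^sup>T \<Sigma> (b - c g) \<ge> 0\<close>, where \<open>b\<close> and \<open>g\<close> are the \<open>i\<close>-th columns of \<^term>\<open>phi_X X \<phi>\<close>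
  and \<open>\<phi> \<phi>\<^sup>T\<close>.
\<close>
lemma phi_X_diag_lower:
  fixes c :: real and i :: 'p
  defines "g \<equiv> \<lambda>k. (\<phi> ** transpose \<phi>) $ k $ i"
  shows "B $ i $ i \<ge> 2 * c * g i - c\<^sup>2 * (\<Sum>k\<in>UNIV. lam k * (g k)\<^sup>2)"
proof -
  have "B ** (diag_matrix lam ** (\<phi> ** transpose \<phi>)) = \<phi> ** transpose \<phi>"
    using phi_X_gram_mult[OF nonsing] by (simp add: gram matrix_mul_assoc)
  then have "g i = (B ** (diag_matrix lam ** (\<phi> ** transpose \<phi>))) $ i $ i" by (simp add: g_def)
  also have "\<dots> = (\<Sum>k\<in>UNIV. lam k * (B $ i $ k * g k))"
    by (subst matrix_matrix_mult_def) (simp add: diag_matrix_mult_left g_def mult_ac)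
  finally have g: "g i = (\<Sum>k\<in>UNIV. lam k * (B $ i $ k * g k))" .
  have "0 \<le> (\<Sum>k\<in>UNIV. lam k * (B $ i $ k - c * g k)\<^sup>2)"
    by (intro sum_nonneg mult_nonneg_nonneg lam_nonneg) auto
  also have "\<dots> = (\<Sum>k\<in>UNIV. lam k * (B $ i $ k)\<^sup>2) - 2 * c * (\<Sum>k\<in>UNIV. lam k * (B $ i $ k * g k))
      + c\<^sup>2 * (\<Sum>k\<in>UNIV. lam k * (g k)\<^sup>2)"
    by (simp add: power2_diff power_mult_distrib sum_distrib_left sum.distrib sum_subtractf algebra_simps)
  finally show ?thesis unfolding g[symmetric] phi_X_diag[symmetric] by linarith
qed

end

end

text \<open>By the normal equations the residual at \<gamma>0 is orthogonal to the range of
  \<open>X ** \<phi>\<close>. Pythagoras makes \<gamma>0 a minimiser, and invertibility of the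
  compressed Gram matrix makes it the only one.\<close>

lemma compressed_ls_eq:
  fixes \<phi> :: "real^'d^'p" and X :: "real^'p^'n"
  assumes "det (compressed_gram X \<phi>) \<noteq> 0"
  shows "compressed_ls X \<phi> Y = phi_X X \<phi> *v (transpose X *v Y)"
proof -
  let ?Z = "X ** \<phi>"
  let ?A = "compressed_gram X \<phi>"
  define f where "f \<equiv> \<lambda>\<gamma>. (norm (Y - ?Z *v \<gamma>))\<^sup>2"
  define \<gamma>0 where "\<gamma>0 = matrix_inv ?A *v (transpose \<phi> *v (transpose X *v Y))"
  have A: "?A = transpose ?Z ** ?Z"
    by (simp add: compressed_gram_def matrix_transpose_mul matrix_mul_assoc)
  have "?A *v \<gamma>0 = transpose \<phi> *v (transpose X *v Y)"
    unfolding \<gamma>0_def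
    by (subst matrix_vector_mul_assoc) (simp only: matrix_inv_inverse[OF assms] matrix_vector_mul_lid)
  then have normal_eq: "transpose ?Z *v (Y - ?Z *v \<gamma>0) = 0"
    by (simp add: A matrix_vector_mult_diff_distrib matrix_vector_mul_assoc matrix_transpose_mul
        matrix_mul_assoc del: transpose_matrix_vector)
  have f: "f \<gamma> = f \<gamma>0 + (norm (?Z *v (\<gamma> - \<gamma>0)))\<^sup>2" for \<gamma>
  proof -
    have "(Y - ?Z *v \<gamma>0) \<bullet> (?Z *v (\<gamma> - \<gamma>0)) = 0"
      using normal_eq by (simp flip: dot_lmul_matrix)
    moreover have "Y - ?Z *v \<gamma> = (Y - ?Z *v \<gamma>0) - ?Z *v (\<gamma> - \<gamma>0)"
      by (simp add: matrix_vector_mult_diff_distrib)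
    ultimately show ?thesis
      unfolding f_def by (simp only: power2_norm_eq_inner) (simp add: inner_diff inner_commute)
  qed
  define \<gamma>1 where "\<gamma>1 = arg_min f (\<lambda>_. True)"
  \<comment> \<open>\<open>arg_min\<close> is an arbitrary choice among minimisers, so at this point
    only the minimal value is known; the identity \<open>f\<close> then forces the two points to
    agree.\<close>
  have "f \<gamma>1 = f \<gamma>0"
    unfolding \<gamma>1_def
  proof (rule arg_min_equality)
    fix \<gamma> show "f \<gamma>0 \<le> f \<gamma>" by (subst f[of \<gamma>]) simp
  qed simp
  then have "?Z *v (\<gamma>1 - \<gamma>0) = 0" using f[of \<gamma>1] by simp
  then have "?A *v (\<gamma>1 - \<gamma>0) = 0"
    by (simp only: A matrix_vector_mul_assoc[symmetric] matrix_vector_mult_0_right)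
  then have "matrix_inv ?A *v (?A *v (\<gamma>1 - \<gamma>0)) = 0" by simp
  then have "\<gamma>1 = \<gamma>0"
    by (simp only: matrix_vector_mul_assoc matrix_inv_inverse[OF assms] matrix_vector_mul_lid) simp
  then show ?thesis
    by (simp add: compressed_ls_def \<gamma>1_def \<gamma>0_def f_def phi_X_def compressed_gram_def
        matrix_vector_mul_assoc matrix_mul_assoc del: transpose_matrix_vector)
qed


section \<open>A projection with invertible compressed Gram matrix\<close>

context diagonal_gram
begin

text \<open>Columns with eigenvalue 0 vanish, so the other columns span the column space.\<close>

lemma rank_le_card: "rank X \<le> card {i. lam i \<noteq> 0}"
proof -
  have "columns X \<subseteq> insert 0 ((\<lambda>i. column i X) ` {i. lam i \<noteq> 0})"
    by (auto simp: columns_def dest: column_eq_0)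
  also have "\<dots> \<subseteq> span ((\<lambda>i. column i X) ` {i. lam i \<noteq> 0})"
    by (auto intro: span_base span_zero)
  finally have "rank X \<le> card ((\<lambda>i. column i X) ` {i. lam i \<noteq> 0})"
    by (simp add: column_rank_def dim_le_card)
  also have "\<dots> \<le> card {i. lam i \<noteq> 0}" by (rule card_image_le) simp
  finally show ?thesis .
qed

text \<open>Supplies a point where the determinant, a polynomial in the entries of \<phi>, is
  nonzero.\<close>

lemma nonsingular_exists:
  assumes "rank X \<ge> CARD('d)"
  obtains \<phi> :: "real^'d^'p" where "det (compressed_gram X \<phi>) \<noteq> 0"
proof -
  have "CARD('d) \<le> card {i. lam i \<noteq> 0}" using assms rank_le_card by linarith
  then obtain g :: "'d \<Rightarrow> 'p" where g: "range g \<subseteq> {i. lam i \<noteq> 0}" "inj g"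
    using card_le_inj[of "UNIV :: 'd set" "{i. lam i \<noteq> 0}"] by auto
  \<comment> \<open>The matrix that selects d coordinates with nonzero eigenvalues; compression then
    keeps exactly these eigenvalues on the diagonal.\<close>
  define \<phi> :: "real^'d^'p" where "\<phi> = (\<chi> i j. if i = g j then 1 else 0)"
  have "compressed_gram X \<phi> = transpose \<phi> ** (diag_matrix lam ** \<phi>)"
    by (simp add: compressed_gram_def matrix_mul_assoc flip: gram)
  also have "\<dots> = diag_matrix (lam \<circ> g)"
  proof -
    have "(transpose \<phi> ** (diag_matrix lam ** \<phi>)) $ i $ j = diag_matrix (lam \<circ> g) $ i $ j" for i j
    proof -
      have "(transpose \<phi> ** (diag_matrix lam ** \<phi>)) $ i $ j = (\<Sum>k\<in>UNIV. \<phi> $ k $ i * (lam k * \<phi> $ k $ j))"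
        by (subst matrix_matrix_mult_def) (simp add: diag_matrix_mult_left transpose_def)
      also have "\<dots> = (\<Sum>k\<in>UNIV. if k = g i then lam k * \<phi> $ k $ j else 0)"
        by (intro sum.cong) (auto simp: \<phi>_def)
      also have "\<dots> = lam (g i) * \<phi> $ g i $ j" by simp
      finally show ?thesis using \<open>inj g\<close> by (auto simp: \<phi>_def diag_matrix_def inj_eq)
    qed
    then show ?thesis by (simp add: vec_eq_iff)
  qed
  finally show ?thesis using g(1) by (intro that[of \<phi>]) (auto simp: det_diag_matrix)
qed

end

subsection \<open>A strong law of large numbers for bounded variables\<close>

text \<open>Hoeffding's inequality makes the probability of a fixed deviation geometrically small in
  n, hence summable, and Borel-Cantelli turns this into almost sure convergence.\<close>

lemma (in prob_space) bounded_strong_law: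
  fixes X :: "nat \<Rightarrow> 'a \<Rightarrow> real"
  assumes indep: "indep_vars (\<lambda>_. borel) X UNIV"
    and bounded: "\<And>k. AE \<omega> in M. X k \<omega> \<in> {a..b}"
    and mean: "\<And>k. expectation (X k) = \<mu>"
  shows "AE \<omega> in M. (\<lambda>n. (\<Sum>k<n. X k \<omega>) / real n) \<longlonglongrightarrow> \<mu>"
proof -
  \<comment> \<open>Raising the upper end to at least \<open>a + 1\<close> gives an interval of
    positive length whatever \<open>a\<close> and \<open>b\<close> are.\<close>
  define c where "c = max b (a + 1) - a"
  have "c > 0" by (simp add: c_def)
  have [measurable]: "random_variable borel (X k)" for k
    using indep by (auto simp: indep_vars_def)
  define A where "A e n = {\<omega> \<in> space M. \<bar>(\<Sum>k<n. X k \<omega>) - real n * \<mu>\<bar> \<ge> real n * e}" for e n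
  have [measurable]: "A e n \<in> sets M" for e n unfolding A_def by measurable
  have A: "prob (A e n) \<le> 2 * exp (- 2 * e\<^sup>2 / c\<^sup>2) ^ n" if "e > 0" for e n
  proof (cases "n = 0")
    case True
    then show ?thesis using order_trans[OF prob_le_1[of "A e n"], of 2] by simp
  next
    case False
    interpret Hoeffding_ineq M "{..<n}" X "\<lambda>_. a" "\<lambda>_. max b (a + 1)" "real n * \<mu>"
    proof unfold_locales
      show "indep_vars (\<lambda>_. borel) X {..<n}"
        using indep by (rule indep_vars_subset) simp
      show "AE \<omega> in M. X i \<omega> \<in> {a..max b (a + 1)}" for i
        using bounded[of i] by eventually_elim auto
      show "real n * \<mu> \<equiv> \<Sum>i<n. expectation (X i)"
        by (simp add: mean)
    qed simp
    have "prob (A e n) \<le> 2 * exp (- 2 * (real n * e)\<^sup>2 / (real n * c\<^sup>2))"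
      using Hoeffding_ineq_abs_ge[of "real n * e"] that False \<open>c > 0\<close>
      by (simp add: A_def flip: c_def)
    also have "- 2 * (real n * e)\<^sup>2 / (real n * c\<^sup>2) = real n * (- 2 * e\<^sup>2 / c\<^sup>2)"
      using False \<open>c > 0\<close> by (simp add: power2_eq_square field_simps)
    finally show ?thesis by (simp only: exp_of_nat_mult)
  qed
  \<comment> \<open>Thresholds 1 / (m + 1) suffice for convergence, and there are countably many, so
    the exceptional null sets can be united.\<close>
  have "AE \<omega> in M. \<forall>\<^sub>F n in sequentially. \<omega> \<in> space M - A (1 / real (Suc m)) n" for m
  proof (rule borel_cantelli_AE1)
    let ?q = "exp (- 2 * (1 / real (Suc m))\<^sup>2 / c\<^sup>2)"
    have "?q < 1" using \<open>c > 0\<close> by simp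
    then have "summable (\<lambda>n. 2 * ?q ^ n)" by (intro summable_mult summable_geometric) simp
    then show "summable (\<lambda>n. prob (A (1 / real (Suc m)) n))"
      by (rule summable_comparison_test_ev[rotated]) (auto intro!: always_eventually A[of "1 / real (Suc m)", simplified])
  qed (simp_all add: emeasure_eq_measure)
  then have "AE \<omega> in M. \<forall>m. \<forall>\<^sub>F n in sequentially. \<omega> \<in> space M - A (1 / real (Suc m)) n"
    by (simp add: AE_all_countable)
  then show ?thesis
  proof eventually_elim
    case (elim \<omega>)
    show ?case
    proof (rule tendstoI)
      fix r :: real assume "r > 0"
      then obtain m where m: "1 / real (Suc m) < r"
        using reals_Archimedean[of r] by (auto simp: inverse_eq_divide)
      have "\<forall>\<^sub>F n in sequentially. \<omega> \<in> space M - A (1 / real (Suc m)) n" using elim by blast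
      then show "\<forall>\<^sub>F n in sequentially. dist ((\<Sum>k<n. X k \<omega>) / real n) \<mu> < r"
        using eventually_gt_at_top[of 0]
      proof eventually_elim
        case (elim n)
        then have "\<bar>(\<Sum>k<n. X k \<omega>) - real n * \<mu>\<bar> < real n * (1 / real (Suc m))"
          by (auto simp: A_def not_le)
        also have "\<dots> < real n * r" using m \<open>n > 0\<close> by (simp only: mult_less_cancel_left_pos of_nat_0_less_iff)
        finally have "\<bar>(\<Sum>k<n. X k \<omega>) - real n * \<mu>\<bar> / real n < r"
          using \<open>n > 0\<close> by (simp add: field_simps)
        moreover have "(\<Sum>k<n. X k \<omega>) / real n - \<mu> = ((\<Sum>k<n. X k \<omega>) - real n * \<mu>) / real n"
          using \<open>n > 0\<close> by (simp add: field_simps)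
        ultimately show ?case by (simp add: dist_real_def)
      qed
    qed
  qed
qed

subsection \<open>Zero sets of polynomials\<close>

text \<open>Fubini, one coordinate at a time. Starting from the point \<open>z\<close>, each newly
  released coordinate has only finitely many roots over almost every choice of those released
  before, and an atomless measure ignores finite sets.\<close>

lemma AE_PiM_nonzero:
  fixes f :: "('i::finite \<Rightarrow> real) \<Rightarrow> real"
  assumes "product_sigma_finite M"
    and sets_M: "\<And>i. sets (M i) = sets borel"
    and atomless: "\<And>i c. emeasure (M i) {c} = 0"
    and f [measurable]: "f \<in> borel_measurable (PiM UNIV (\<lambda>_. borel))"
    and roots: "\<And>x i. f x \<noteq> 0 \<Longrightarrow> finite {t. f (x(i := t)) = 0}"
    and base: "f z \<noteq> 0"
  shows "AE x in PiM UNIV M. f x \<noteq> 0"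
proof -
  interpret product_sigma_finite M by fact
  note [measurable_cong] = sets_M
  \<comment> \<open>Coordinates in \<open>I\<close> are free, all others are frozen at the nonroot
    \<open>z\<close>; the induction enlarges \<open>I\<close> from the empty set to
    \<open>UNIV\<close>.\<close>
  define ov where "ov I y = (\<lambda>i. if i \<in> I then y i else z i)" for I and y :: "'i \<Rightarrow> real"
  have [measurable]: "(\<lambda>y. ov I y) \<in> measurable (PiM I M) (PiM UNIV (\<lambda>_. borel))" for I
    unfolding ov_def
  proof (rule measurable_PiM_single')
    show "(\<lambda>y. if i \<in> I then y i else z i) \<in> borel_measurable (PiM I M)" for i
      by (cases "i \<in> I") simp_all
  qed auto
  have "AE y in PiM I M. f (ov I y) \<noteq> 0" for I
    using finite[of I]
  proof (induction I rule: finite_induct)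
    case empty
    then show ?case using base by (simp add: ov_def)
  next
    case (insert i I)
    let ?h = "\<lambda>y. indicator {0} (f (ov (insert i I) y)) :: ennreal"
    have "ov (insert i I) (y(i := t)) = (ov I y)(i := t)" for y t
      by (auto simp: ov_def)
    then have h: "?h (y(i := t)) = indicator {t. f ((ov I y)(i := t)) = 0} t" for y t
      by (simp add: indicator_def)
    have "(\<integral>\<^sup>+ y. ?h y \<partial>PiM (insert i I) M) = (\<integral>\<^sup>+ y. (\<integral>\<^sup>+ t. ?h (y(i := t)) \<partial>M i) \<partial>PiM I M)"
      using insert.hyps by (intro product_nn_integral_insert) measurable
    also have "\<dots> = (\<integral>\<^sup>+ y. 0 \<partial>PiM I M)"
    proof (rule nn_integral_cong_AE)
      show "AE y in PiM I M. (\<integral>\<^sup>+ t. ?h (y(i := t)) \<partial>M i) = 0"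
        using insert.IH
      proof eventually_elim
        case (elim y)
        then have fin: "finite {t. f ((ov I y)(i := t)) = 0}" by (rule roots)
        then have "emeasure (M i) {t. f ((ov I y)(i := t)) = 0} = (\<Sum>t\<in>{t. f ((ov I y)(i := t)) = 0}. emeasure (M i) {t})"
          by (intro emeasure_eq_sum_singleton) (auto simp: sets_M)
        then show ?case unfolding h using fin
          by (subst nn_integral_indicator) (auto simp: sets_M atomless intro: finite_imp_closed borel_closed)
      qed
    qed
    finally have "(\<integral>\<^sup>+ y. ?h y \<partial>PiM (insert i I) M) = 0" by simp
    moreover have "?h \<in> borel_measurable (PiM (insert i I) M)" by measurable
    ultimately have "AE y in PiM (insert i I) M. ?h y = 0"
      by (simp add: nn_integral_0_iff_AE)
    then show ?case by eventually_elim (auto simp: indicator_def split: if_splits)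
  qed
  from this[of UNIV] show ?thesis by (simp add: ov_def)
qed

lemma real_polynomial_function_finite_roots:
  fixes f :: "real \<Rightarrow> real"
  assumes "real_polynomial_function f" and "f a \<noteq> 0"
  shows "finite {t. f t = 0}"
proof -
  obtain c n where f: "f = (\<lambda>x. \<Sum>i\<le>n. c i * x ^ i)"
    using assms(1) by (auto simp: real_polynomial_function_iff_sum)
  then have "\<exists>k\<le>n. c k \<noteq> 0" using assms(2) by (metis (no_types, lifting) atMost_iff mult_eq_0_iff sum.neutral)
  then show ?thesis unfolding f by (rule polyfun_finite_roots[THEN iffD2])
qed

lemma real_polynomial_function_det:
  fixes A :: "'x::real_normed_vector \<Rightarrow> real^'k^'k"
  assumes "\<And>i j. real_polynomial_function (\<lambda>x. A x $ i $ j)"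
  shows "real_polynomial_function (\<lambda>x. det (A x))"
  unfolding det_def
proof (intro real_polynomial_function_sum)
  fix p
  show "real_polynomial_function (\<lambda>x. of_int (sign p) * (\<Prod>i\<in>UNIV. A x $ i $ p i))"
    by (intro real_polynomial_function.intros(4)[OF real_polynomial_function.intros(2)]
        real_polynomial_function_prod assms) simp
qed (simp add: finite_permutations)

lemma real_polynomial_function_matrix_mult:
  fixes A :: "'x::real_normed_vector \<Rightarrow> real^'k^'m" and B :: "'x \<Rightarrow> real^'l^'k"
  assumes "\<And>i j. real_polynomial_function (\<lambda>x. A x $ i $ j)"
    and "\<And>i j. real_polynomial_function (\<lambda>x. B x $ i $ j)"
  shows "real_polynomial_function (\<lambda>x. (A x ** B x) $ i $ j)"
  unfolding matrix_matrix_mult_def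
  by (simp, intro real_polynomial_function_sum real_polynomial_function.intros(4) assms) simp

subsection \<open>Measurability of matrix operations\<close>

lemma borel_measurable_vec_iff:
  fixes f :: "'a \<Rightarrow> 'b::euclidean_space^'k"
  shows "f \<in> borel_measurable M \<longleftrightarrow> (\<forall>i. (\<lambda>x. f x $ i) \<in> borel_measurable M)"
proof -
  have "f \<in> borel_measurable M \<longleftrightarrow> (\<forall>i. \<forall>u\<in>Basis. (\<lambda>x. f x \<bullet> axis i u) \<in> borel_measurable M)"
    by (subst borel_measurable_euclidean_space) (auto simp: Basis_vec_def)
  also have "\<dots> \<longleftrightarrow> (\<forall>i. (\<lambda>x. f x $ i) \<in> borel_measurable M)"
    by (subst borel_measurable_euclidean_space) (simp add: inner_axis)
  finally show ?thesis .
qed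

lemma borel_measurable_vec_nth [measurable (raw)]:
  fixes f :: "'a \<Rightarrow> 'b::euclidean_space^'k"
  shows "f \<in> borel_measurable M \<Longrightarrow> (\<lambda>x. f x $ i) \<in> borel_measurable M"
  by (simp add: borel_measurable_vec_iff)

lemma borel_measurable_det:
  fixes A :: "'x \<Rightarrow> real^'k^'k"
  assumes "A \<in> borel_measurable M"
  shows "(\<lambda>x. det (A x)) \<in> borel_measurable M"
  unfolding det_def using assms by measurable

text \<open>Column j of the inverse solves a linear system with right-hand side
  \<open>axis j 1\<close>. Cramer's rule makes its entries quotients of determinants, from which
  measurability can be read off.\<close>

lemma matrix_inv_eq_cramer:
  fixes A :: "real^'k^'k"
  assumes "det A \<noteq> 0"
  shows "matrix_inv A $ i $ j = det (\<chi> a b. if b = i then axis j 1 $ a else A $ a $ b) / det A"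
proof -
  have "A *v (matrix_inv A *v axis j 1) = axis j 1"
    by (simp add: matrix_vector_mul_assoc matrix_inv_inverse[OF assms])
  then have "matrix_inv A *v axis j 1 = (\<chi> k. det (\<chi> a b. if b = k then axis j 1 $ a else A $ a $ b) / det A)"
    by (simp add: cramer[OF assms])
  then have "(matrix_inv A *v axis j 1) $ i = det (\<chi> a b. if b = i then axis j 1 $ a else A $ a $ b) / det A"
    by simp
  then show ?thesis by (simp add: matrix_vector_mul_component inner_axis)
qed

text \<open>Off the invertible matrices, \<^const>\<open>matrix_inv\<close> is one fixed junk value.\<close>
lemma borel_measurable_matrix_inv:
  fixes A :: "'x \<Rightarrow> real^'k^'k"
  assumes [measurable]: "A \<in> borel_measurable M"
  shows "(\<lambda>x. matrix_inv (A x)) \<in> borel_measurable M"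
proof -
  define J :: "real^'k^'k" where "J = (SOME C. False)"
  have sing: "matrix_inv C = J" if "det C = 0" for C :: "real^'k^'k"
  proof -
    have "\<not> (C ** C' = mat 1 \<and> C' ** C = mat 1)" for C'
      using that invertible_det_nz[of C] by (auto simp: invertible_def)
    then have "(\<lambda>C'. C ** C' = mat 1 \<and> C' ** C = mat 1) = (\<lambda>_. False)" by blast
    then show ?thesis by (simp only: matrix_inv_def J_def)
  qed
  have eq: "matrix_inv (A x) $ i $ j = (if det (A x) = 0 then J $ i $ j else
      det (\<chi> a b. if b = i then axis j 1 $ a else A x $ a $ b) / det (A x))" for x i j
    by (simp add: sing matrix_inv_eq_cramer)
  have "(\<lambda>x. det (\<chi> a b. if b = i then axis j 1 $ a else A x $ a $ b)) \<in> borel_measurable M" for i j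
    by (rule borel_measurable_det) (simp add: borel_measurable_vec_iff)
  note this[measurable] borel_measurable_det[measurable]
  show ?thesis unfolding borel_measurable_vec_iff eq by measurable
qed

lemma borel_measurable_matrix_mult [measurable (raw)]:
  fixes A :: "'x \<Rightarrow> real^'k^'m" and B :: "'x \<Rightarrow> real^'l^'k"
  assumes [measurable]: "A \<in> borel_measurable M" "B \<in> borel_measurable M"
  shows "(\<lambda>x. A x ** B x) \<in> borel_measurable M"
  by (simp add: borel_measurable_vec_iff matrix_matrix_mult_def)

lemma borel_measurable_transpose [measurable (raw)]:
  fixes A :: "'x \<Rightarrow> real^'k^'m"
  assumes [measurable]: "A \<in> borel_measurable M"
  shows "(\<lambda>x. transpose (A x)) \<in> borel_measurable M"
  by (simp add: borel_measurable_vec_iff transpose_def)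

lemma borel_measurable_phi_X [measurable]:
  "(\<lambda>\<phi>::real^'d^'p. phi_X X \<phi>) \<in> borel_measurable borel"
  unfolding phi_X_def
  by (intro borel_measurable_matrix_mult borel_measurable_matrix_inv borel_measurable_transpose) measurable

subsection \<open>Gaussian random projections\<close>

definition matrix_of_family :: "('p \<times> 'd \<Rightarrow> real) \<Rightarrow> real^'d^'p"
  where "matrix_of_family x = (\<chi> i j. x (i, j))"

text \<open>A law that does not mention the underlying probability space. Every random projection
  has it, so expectations can be carried from one projection to another or to a sign-flipped
  copy.\<close>

definition projection_law :: "(real^'d^'p) measure"
  where "projection_law = distr (PiM UNIV (\<lambda>_. density lborel (normal_density 0 (1 / sqrt (real CARD('d))))))
      borel matrix_of_family"

lemma measurable_matrix_of_family [measurable]: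
  "matrix_of_family \<in> borel_measurable (PiM UNIV (\<lambda>_. borel))"
  by (simp add: borel_measurable_vec_iff matrix_of_family_def)

lemma random_projection_measurable:
  assumes "random_projection M \<phi>"
  shows "\<phi> \<in> borel_measurable M"
proof -
  have "(\<lambda>\<omega>. \<phi> \<omega> $ i $ j) \<in> measurable M lborel" for i j
    using assms by (auto simp only: random_projection_def dest: distributed_measurable)
  then show ?thesis by (simp add: borel_measurable_vec_iff)
qed

lemma (in prob_space) distr_random_projection:
  fixes \<phi> :: "'a \<Rightarrow> real^'d^'p"
  assumes "random_projection M \<phi>"
  shows "distr M borel \<phi> = projection_law"
proof -
  let ?z = "\<lambda>(i, j) \<omega>. \<phi> \<omega> $ i $ j"
  note [measurable] = random_projection_measurable[OF assms]
  have [measurable]: "?z e \<in> borel_measurable M" for e by (cases e) simp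
  have "distr M (PiM UNIV (\<lambda>_. borel)) (\<lambda>\<omega>. \<lambda>e\<in>UNIV. ?z e \<omega>) = PiM UNIV (\<lambda>e. distr M borel (?z e))"
    using assms by (subst indep_vars_iff_distr_eq_PiM[symmetric]) (simp_all add: random_projection_def)
  also have "(\<lambda>e. distr M borel (?z e)) = (\<lambda>_. density lborel (normal_density 0 (1 / sqrt (real CARD('d)))))"
  proof
    fix e :: "'p \<times> 'd"
    \<comment> \<open>\<open>lborel\<close> and \<open>borel\<close> have the same measurable sets,
      and \<open>distr\<close> uses its target only through them.\<close>
    have "distr M borel (?z e) = distr M lborel (?z e)" by (rule distr_cong) simp_all
    also have "\<dots> = density lborel (normal_density 0 (1 / sqrt (real CARD('d))))"
      using assms by (cases e) (auto simp: random_projection_def dest!: distributed_distr_eq_density)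
    finally show "distr M borel (?z e) = density lborel (normal_density 0 (1 / sqrt (real CARD('d))))" .
  qed
  finally have "projection_law = distr (distr M (PiM UNIV (\<lambda>_. borel)) (\<lambda>\<omega>. \<lambda>e\<in>UNIV. ?z e \<omega>)) borel matrix_of_family"
    by (simp only: projection_law_def)
  also have "\<dots> = distr M borel \<phi>"
    by (subst distr_distr) (auto simp: comp_def matrix_of_family_def intro!: distr_cong measurable_restrict)
  finally show ?thesis by simp
qed

lemma (in prob_space) random_projection_expectation:
  fixes \<phi> :: "'a \<Rightarrow> real^'d^'p" and h :: "real^'d^'p \<Rightarrow> real"
  assumes "random_projection M \<phi>" and "h \<in> borel_measurable borel"
  shows "expectation (\<lambda>\<omega>. h (\<phi> \<omega>)) = integral\<^sup>L projection_law h"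
  using assms by (subst distr_random_projection[OF assms(1), symmetric])
    (simp add: integral_distr random_projection_measurable)

text \<open>The determinant is a polynomial in the Gaussian entries and is not identically zero by
  \<open>nonsingular_exists\<close>, so its zero set is null.\<close>

lemma (in prob_space) AE_random_projection_nonsingular:
  fixes \<phi> :: "'a \<Rightarrow> real^'d^'p"
  assumes "random_projection M \<phi>" and "diagonal_gram X lam" and "rank X \<ge> CARD('d)"
  shows "AE \<omega> in M. det (compressed_gram X (\<phi> \<omega>)) \<noteq> 0"
proof -
  let ?N = "\<lambda>_::'p \<times> 'd. density lborel (normal_density 0 (1 / sqrt (real CARD('d))))"
  let ?f = "\<lambda>x. det (compressed_gram X (matrix_of_family x :: real^'d^'p))"
  have [measurable]: "(\<lambda>\<phi>::real^'d^'p. det (compressed_gram X \<phi>)) \<in> borel_measurable borel"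
    unfolding compressed_gram_def by (intro borel_measurable_det) measurable
  have [measurable_cong]: "sets (PiM UNIV ?N) = sets (PiM UNIV (\<lambda>_. borel))"
    by (intro sets_PiM_cong) simp_all
  have "AE x in PiM UNIV ?N. ?f x \<noteq> 0"
  proof -
    obtain \<phi>0 :: "real^'d^'p" where \<phi>0: "det (compressed_gram X \<phi>0) \<noteq> 0"
      using diagonal_gram.nonsingular_exists[OF assms(2,3)] .
    show ?thesis
    proof (rule AE_PiM_nonzero[where z = "\<lambda>(i, j). \<phi>0 $ i $ j"])
      show "product_sigma_finite ?N"
        by (intro product_sigma_finite.intro prob_space_imp_sigma_finite prob_space_normal_density) simp
      show "emeasure (?N e) {c} = 0" for e c
        by (subst emeasure_density) (auto intro!: nn_integral_null_set simp: null_sets_def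
            cong: nn_integral_cong_simp)
      show "?f \<in> borel_measurable (PiM UNIV (\<lambda>_. borel))" by measurable
      show "finite {t. ?f (x(e := t)) = 0}" if "?f x \<noteq> 0" for x e
      proof (rule real_polynomial_function_finite_roots)
        have entry: "real_polynomial_function (\<lambda>t. (matrix_of_family (x(e := t)) :: real^'d^'p) $ i $ j)" for i j
          by (cases "e = (i, j)") (auto simp: matrix_of_family_def intro: real_polynomial_function.intros)
        show "real_polynomial_function (\<lambda>t. ?f (x(e := t)))"
          unfolding compressed_gram_def
          by (intro real_polynomial_function_det real_polynomial_function_matrix_mult entry)
            (simp_all add: transpose_def entry real_polynomial_function.intros)
        show "?f (x(e := x e)) \<noteq> 0" using that by simp
      qed
      have "matrix_of_family (\<lambda>(i, j). \<phi>0 $ i $ j) = \<phi>0"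
        by (simp add: matrix_of_family_def)
      then show "?f (\<lambda>(i, j). \<phi>0 $ i $ j) \<noteq> 0" using \<phi>0 by simp
    qed simp
  qed
  then have "AE \<phi> in distr M borel \<phi>. det (compressed_gram X \<phi>) \<noteq> 0"
    unfolding distr_random_projection[OF assms(1)] projection_law_def
    by (subst AE_distr_iff) auto
  then show ?thesis
    by (subst (asm) AE_distr_iff) (auto simp: random_projection_measurable[OF assms(1)])
qed

section \<open>Moments of Gaussian projections\<close>

lemma (in prob_space) random_projection_moments:
  fixes \<phi> :: "'a \<Rightarrow> real^'d^'p"
  assumes "random_projection M \<phi>"
  shows "integrable M (\<lambda>\<omega>. (\<phi> \<omega> $ i $ j) ^ n)"
    and "expectation (\<lambda>\<omega>. \<phi> \<omega> $ i $ j) = 0"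
    and "expectation (\<lambda>\<omega>. (\<phi> \<omega> $ i $ j)\<^sup>2) = 1 / real CARD('d)"
    and "expectation (\<lambda>\<omega>. (\<phi> \<omega> $ i $ j) ^ 4) = 3 / (real CARD('d))\<^sup>2"
proof -
  let ?s = "1 / sqrt (real CARD('d))"
  have s: "?s > 0" by simp
  have s2: "?s\<^sup>2 = 1 / real CARD('d)" by (simp add: power_divide)
  have D: "distributed M lborel (\<lambda>\<omega>. \<phi> \<omega> $ i $ j) (normal_density 0 ?s)"
    using assms by (simp add: random_projection_def)
  show "integrable M (\<lambda>\<omega>. (\<phi> \<omega> $ i $ j) ^ n)" for n
    using integrable_normal_moment[OF s, of 0 n]
    by (subst distributed_integrable[OF D, symmetric]) simp_all
  have E: "expectation (\<lambda>\<omega>. (\<phi> \<omega> $ i $ j) ^ n) = (\<integral>x. normal_density 0 ?s x * x ^ n \<partial>lborel)" for n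
    by (rule distributed_integral[OF D, symmetric]) simp_all
  show "expectation (\<lambda>\<omega>. \<phi> \<omega> $ i $ j) = 0"
    using integral_normal_moment_odd[OF s, of 0 0] E[of 1] by simp
  show "expectation (\<lambda>\<omega>. (\<phi> \<omega> $ i $ j)\<^sup>2) = 1 / real CARD('d)"
    using integral_normal_moment_even[OF s, of 0 1] E[of 2] by (simp add: s2)
  show "expectation (\<lambda>\<omega>. (\<phi> \<omega> $ i $ j) ^ 4) = 3 / (real CARD('d))\<^sup>2"
    using integral_normal_moment_even[OF s, of 0 2] E[of 4]
    by (simp add: s2 fact_numeral power2_eq_square)
qed

text \<open>Independence factors the expectation of any monomial; letting \<open>n\<close> vary with
  the entry covers all monomials.\<close>

lemma (in prob_space) random_projection_mixed_moment:
  fixes \<phi> :: "'a \<Rightarrow> real^'d^'p" and n :: "'p \<times> 'd \<Rightarrow> nat"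
  assumes "random_projection M \<phi>" and "finite I"
  shows "integrable M (\<lambda>\<omega>. \<Prod>e\<in>I. (\<phi> \<omega> $ fst e $ snd e) ^ n e)"
    and "expectation (\<lambda>\<omega>. \<Prod>e\<in>I. (\<phi> \<omega> $ fst e $ snd e) ^ n e) =
      (\<Prod>e\<in>I. expectation (\<lambda>\<omega>. (\<phi> \<omega> $ fst e $ snd e) ^ n e))"
proof -
  have "indep_vars (\<lambda>_. borel) (\<lambda>e \<omega>. \<phi> \<omega> $ fst e $ snd e) UNIV"
    using assms(1) by (simp add: random_projection_def case_prod_unfold)
  then have "indep_vars (\<lambda>_. borel) (\<lambda>e \<omega>. \<phi> \<omega> $ fst e $ snd e) I"
    by (rule indep_vars_subset) simp
  then have "indep_vars (\<lambda>_. borel) (\<lambda>e \<omega>. (\<phi> \<omega> $ fst e $ snd e) ^ n e) I"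
    by (rule indep_vars_compose2[where Y = "\<lambda>e x. x ^ n e"]) simp
  note * = \<open>finite I\<close> this random_projection_moments(1)[OF assms(1)]
  show "integrable M (\<lambda>\<omega>. \<Prod>e\<in>I. (\<phi> \<omega> $ fst e $ snd e) ^ n e)"
    by (rule indep_vars_integrable[OF *])
  show "expectation (\<lambda>\<omega>. \<Prod>e\<in>I. (\<phi> \<omega> $ fst e $ snd e) ^ n e) =
      (\<Prod>e\<in>I. expectation (\<lambda>\<omega>. (\<phi> \<omega> $ fst e $ snd e) ^ n e))"
    by (rule indep_vars_lebesgue_integral[OF *])
qed

lemma (in prob_space) random_projection_outer_diag:
  fixes \<phi> :: "'a \<Rightarrow> real^'d^'p"
  assumes "random_projection M \<phi>"
  shows "integrable M (\<lambda>\<omega>. (\<phi> \<omega> ** transpose (\<phi> \<omega>)) $ i $ i)"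
    and "expectation (\<lambda>\<omega>. (\<phi> \<omega> ** transpose (\<phi> \<omega>)) $ i $ i) = 1"
proof -
  have eq: "(\<phi> \<omega> ** transpose (\<phi> \<omega>)) $ i $ i = (\<Sum>k\<in>UNIV. (\<phi> \<omega> $ i $ k)\<^sup>2)" for \<omega>
    by (simp add: matrix_matrix_mult_def transpose_def power2_eq_square)
  show "integrable M (\<lambda>\<omega>. (\<phi> \<omega> ** transpose (\<phi> \<omega>)) $ i $ i)"
    unfolding eq by (intro Bochner_Integration.integrable_sum random_projection_moments[OF assms])
  show "expectation (\<lambda>\<omega>. (\<phi> \<omega> ** transpose (\<phi> \<omega>)) $ i $ i) = 1"
    unfolding eq by (simp add: random_projection_moments[OF assms])
qed

lemma (in prob_space) random_projection_outer_square:
  fixes \<phi> :: "'a \<Rightarrow> real^'d^'p"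
  assumes "random_projection M \<phi>"
  shows "integrable M (\<lambda>\<omega>. ((\<phi> \<omega> ** transpose (\<phi> \<omega>)) $ j $ i)\<^sup>2)"
    and "expectation (\<lambda>\<omega>. ((\<phi> \<omega> ** transpose (\<phi> \<omega>)) $ j $ i)\<^sup>2) =
      (if j = i then 1 + 2 / real CARD('d) else 1 / real CARD('d))"
proof -
  let ?d = "real CARD('d)"
  define t where "t k l \<omega> = \<phi> \<omega> $ j $ k * \<phi> \<omega> $ i $ k * (\<phi> \<omega> $ j $ l * \<phi> \<omega> $ i $ l)" for k l \<omega>
  have eq: "((\<phi> \<omega> ** transpose (\<phi> \<omega>)) $ j $ i)\<^sup>2 = (\<Sum>k\<in>UNIV. \<Sum>l\<in>UNIV. t k l \<omega>)" for \<omega>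
    by (simp add: matrix_matrix_mult_def transpose_def power2_eq_square sum_product t_def)
  note mixed = random_projection_mixed_moment[OF assms]
  note mom = random_projection_moments[OF assms]
  have t: "integrable M (t k l) \<and> expectation (t k l) =
      (if j = i then (if k = l then 3 / ?d\<^sup>2 else 1 / ?d\<^sup>2) else (if k = l then 1 / ?d\<^sup>2 else 0))" for k l
  proof -
    \<comment> \<open>The coinciding indices decide the monomial: a fourth power, a product of two
      squares of distinct entries (twice), or a product of four distinct entries, which has mean
      0.\<close>
    consider "j = i" "k = l" | "j = i" "k \<noteq> l" | "j \<noteq> i" "k = l" | "j \<noteq> i" "k \<noteq> l" by blast
    then show ?thesis
    proof cases
      case 1
      have "t k l = (\<lambda>\<omega>. (\<phi> \<omega> $ i $ k) ^ 4)"
        using 1 by (simp add: t_def fun_eq_iff power4_eq_xxxx mult_ac)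
      then show ?thesis using 1 by (simp add: mom)
    next
      case 2
      have "t k l = (\<lambda>\<omega>. \<Prod>e\<in>{(i, k), (i, l)}. (\<phi> \<omega> $ fst e $ snd e) ^ 2)"
        using 2 by (simp add: t_def fun_eq_iff power2_eq_square mult_ac)
      then show ?thesis using 2 mixed[of "{(i, k), (i, l)}" "\<lambda>_. 2"]
        by (simp add: mom) (simp add: power2_eq_square)
    next
      case 3
      have "t k l = (\<lambda>\<omega>. \<Prod>e\<in>{(j, k), (i, k)}. (\<phi> \<omega> $ fst e $ snd e) ^ 2)"
        using 3 by (simp add: t_def fun_eq_iff power2_eq_square mult_ac)
      then show ?thesis using 3 mixed[of "{(j, k), (i, k)}" "\<lambda>_. 2"]
        by (simp add: mom) (simp add: power2_eq_square)
    next
      case 4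
      have "t k l = (\<lambda>\<omega>. \<Prod>e\<in>{(j, k), (i, k), (j, l), (i, l)}. (\<phi> \<omega> $ fst e $ snd e) ^ 1)"
        using 4 by (simp add: t_def fun_eq_iff mult_ac)
      then show ?thesis using 4 mixed[of "{(j, k), (i, k), (j, l), (i, l)}" "\<lambda>_. 1"]
        by (simp add: mom)
    qed
  qed
  show "integrable M (\<lambda>\<omega>. ((\<phi> \<omega> ** transpose (\<phi> \<omega>)) $ j $ i)\<^sup>2)"
    unfolding eq by (intro Bochner_Integration.integrable_sum) (simp add: t)
  have "expectation (\<lambda>\<omega>. ((\<phi> \<omega> ** transpose (\<phi> \<omega>)) $ j $ i)\<^sup>2) =
      (\<Sum>k\<in>UNIV. \<Sum>l\<in>UNIV. expectation (t k l))"
    unfolding eq using t by (simp add: Bochner_Integration.integral_sum)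
  \<comment> \<open>Splitting 3/d^2 as 1/d^2 + 2/d^2 separates a constant over all d^2 pairs from an
    excess on the d pairs with \<open>k = l\<close>.\<close>
  also have "\<dots> = (\<Sum>k\<in>(UNIV::'d set). \<Sum>l\<in>(UNIV::'d set). if j = i then 1 / ?d\<^sup>2 + (if k = l then 2 / ?d\<^sup>2 else 0)
      else (if k = l then 1 / ?d\<^sup>2 else 0))"
    by (intro sum.cong refl) (simp add: t field_simps)
  also have "\<dots> = (if j = i then 1 + 2 / ?d else 1 / ?d)"
    by (simp add: sum.distrib power2_eq_square distrib_left)
  finally show "expectation (\<lambda>\<omega>. ((\<phi> \<omega> ** transpose (\<phi> \<omega>)) $ j $ i)\<^sup>2) =
      (if j = i then 1 + 2 / ?d else 1 / ?d)" .
qed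

text \<open>Centred normal densities are symmetric, and entrywise maps preserve independence. This
  is the symmetry that removes the off-diagonal expectations.\<close>

lemma (in prob_space) random_projection_flip_row:
  fixes \<phi> :: "'a \<Rightarrow> real^'d^'p"
  assumes "random_projection M \<phi>"
  shows "random_projection M (\<lambda>\<omega>. diag_matrix (\<lambda>k. if k = i then - 1 else 1) ** \<phi> \<omega>)"
proof -
  let ?s = "1 / sqrt (real CARD('d))"
  let ?Y = "\<lambda>(k, j :: 'd) x :: real. (if k = i then - 1 else 1) * x"
  have "indep_vars (\<lambda>_. borel) (\<lambda>e \<omega>. ?Y e ((\<lambda>(i, j) \<omega>. \<phi> \<omega> $ i $ j) e \<omega>)) UNIV"
    using assms unfolding random_projection_def
    by (intro indep_vars_compose2[where Y = ?Y and M' = "\<lambda>_. borel"]) auto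
  moreover have "distributed M lborel (\<lambda>\<omega>. (if k = i then - 1 else 1) * \<phi> \<omega> $ k $ j) (normal_density 0 ?s)" for k j
  proof -
    have "distributed M lborel (\<lambda>\<omega>. \<phi> \<omega> $ k $ j) (normal_density 0 ?s)"
      using assms by (simp add: random_projection_def)
    from normal_density_affine[OF this, of "- 1" 0] this show ?thesis
      by (cases "k = i") simp_all
  qed
  ultimately show ?thesis
    by (simp add: random_projection_def diag_matrix_mult_left case_prod_unfold)
qed

text \<open>A diagonal sign matrix D satisfies D \<Sigma> D = \<Sigma> for diagonal \<Sigma>. The
  compressed Gram matrix is therefore unchanged and \<open>phi_X\<close> is conjugated by D, which
  negates an entry with exactly one flipped index.\<close>

lemma (in diagonal_gram) phi_X_flip_row:
  fixes \<phi> :: "real^'d^'p"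
  assumes "i \<noteq> j"
  shows "phi_X X (diag_matrix (\<lambda>k. if k = i then - 1 else 1) ** \<phi>) $ i $ j = - phi_X X \<phi> $ i $ j"
proof -
  let ?D = "diag_matrix (\<lambda>k. if k = i then - 1 else 1) :: real^'p^'p"
  have "?D ** (transpose X ** X) ** ?D = transpose X ** X"
    by (simp add: gram vec_eq_iff diag_matrix_mult_left diag_matrix_mult_right) (simp add: diag_matrix_def)
  then have "transpose \<phi> ** (?D ** (transpose X ** X) ** ?D) ** \<phi> = compressed_gram X \<phi>"
    by (simp add: compressed_gram_def matrix_mul_assoc)
  then have "phi_X X (?D ** \<phi>) = ?D ** (phi_X X \<phi> ** ?D)"
    by (simp add: phi_X_def compressed_gram_def matrix_transpose_mul transpose_diag_matrix matrix_mul_assoc)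
  then show ?thesis using assms by (simp add: diag_matrix_mult_left diag_matrix_mult_right)
qed

subsection \<open>The expected projection\<close>

text \<open>The identity \<open>1 - w = l / m\<close> with \<open>m = (1 + 1/d) l + t/d\<close> reflects the factorisations
  \<open>(l + t) ((d + 1) l + t)\<close> and \<open>((d + 1) l + t)\<^sup>2\<close> of numerator and denominator of \<open>w\<close>, up to \<open>d\<close>.\<close>
lemma bias_weight_eq:
  assumes "d > 0" "l > 0" "t \<ge> 0"
  shows "bias_weight d t l = 1 - l / ((1 + 1 / d) * l + t / d)"
proof -
  define q where "q = (d + 1) * l + t"
  have q: "q > 0" unfolding q_def using assms by (intro add_pos_nonneg mult_pos_pos) auto
  have num: "(1 + 1 / d) * l\<^sup>2 + (1 + 2 / d) * l * t + t\<^sup>2 / d = (l + t) * q / d"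
    using assms by (simp add: q_def field_simps power2_eq_square)
  have den: "(d + 2 + 1 / d) * l\<^sup>2 + 2 * (1 + 1 / d) * l * t + t\<^sup>2 / d = q * q / d"
    using assms by (simp add: q_def field_simps power2_eq_square)
  have "(1 + 1 / d) * l + t / d = q / d"
    using assms by (simp add: q_def field_simps)
  moreover have "(l + t) * q / d / (q * q / d) = (l + t) / q"
    using q assms by simp
  moreover have "1 - l / (q / d) = (l + t) / q"
    using q assms by (simp add: field_simps) (simp add: q_def algebra_simps)
  ultimately show ?thesis unfolding bias_weight_def num den by simp
qed

text \<open>Treats a single projection; the theorem interprets it for every member of the
  sequence.\<close>

locale gaussian_compression = prob_space M + diagonal_gram X lam
  for M :: "'w measure" and X :: "real^'p^'n" and lam :: "'p \<Rightarrow> real" +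
  fixes \<phi> :: "'w \<Rightarrow> real^'d^'p"
  assumes proj: "random_projection M \<phi>" and rank: "rank X \<ge> CARD('d)"
begin

abbreviation (input) h where "h \<equiv> eigen_ratio M X \<phi> lam"

lemma measurable_proj [measurable]: "\<phi> \<in> borel_measurable M"
  using proj by (rule random_projection_measurable)

lemma AE_nonsingular: "AE \<omega> in M. det (compressed_gram X (\<phi> \<omega>)) \<noteq> 0"
  using proj diagonal_gram_axioms rank by (rule AE_random_projection_nonsingular)

lemma AE_ratio: "AE \<omega> in M. lam i * phi_X X (\<phi> \<omega>) $ i $ i \<in> {0..1}"
  using AE_nonsingular by eventually_elim (rule ratio_bounds)

lemma integrable_ratio: "integrable M (\<lambda>\<omega>. lam i * phi_X X (\<phi> \<omega>) $ i $ i)"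
proof (rule integrable_const_bound[where B = 1])
  show "AE \<omega> in M. norm (lam i * phi_X X (\<phi> \<omega>) $ i $ i) \<le> 1"
    using AE_ratio[of i] by eventually_elim auto
qed measurable

lemma eigen_ratio_bounds: "h i \<in> {0..1}"
proof -
  have "h i \<ge> 0" unfolding eigen_ratio_def
    using AE_ratio[of i] by (intro integral_nonneg_AE) (auto elim: eventually_mono)
  moreover have "h i \<le> 1" unfolding eigen_ratio_def
    using AE_ratio[of i] by (intro integral_le_const integrable_ratio) (auto elim: eventually_mono)
  ultimately show ?thesis by simp
qed

lemma sum_eigen_ratio: "(\<Sum>i\<in>UNIV. h i) = real CARD('d)"
proof -
  have "(\<Sum>i\<in>UNIV. h i) = expectation (\<lambda>\<omega>. \<Sum>i\<in>UNIV. lam i * phi_X X (\<phi> \<omega>) $ i $ i)"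
    unfolding eigen_ratio_def by (intro Bochner_Integration.integral_sum[symmetric] integrable_ratio)
  also have "\<dots> = expectation (\<lambda>_. real CARD('d))"
  proof (rule integral_cong_AE)
    show "AE \<omega> in M. (\<Sum>i\<in>UNIV. lam i * phi_X X (\<phi> \<omega>) $ i $ i) = real CARD('d)"
      using AE_nonsingular by eventually_elim (rule sum_ratio)
  qed measurable
  finally show ?thesis by (simp add: prob_space)
qed

text \<open>Cauchy-Schwarz against the constant vector gives the lower bound, and h^2 \<le> h on the
  unit interval gives the upper one.\<close>

lemma sum_square_eigen_ratio:
  "(\<Sum>i\<in>UNIV. (h i)\<^sup>2) \<in> {(real CARD('d))\<^sup>2 / real CARD('p) .. real CARD('d)}"
proof -
  have "(real CARD('d))\<^sup>2 \<le> (\<Sum>i\<in>UNIV. (h i)\<^sup>2) * real CARD('p)"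
    using sum_squared_le_sum_of_squares[of h UNIV] by (simp add: sum_eigen_ratio mult.commute)
  moreover have "(\<Sum>i\<in>UNIV. (h i)\<^sup>2) \<le> (\<Sum>i\<in>UNIV. h i)"
    using eigen_ratio_bounds by (intro sum_mono) (auto simp: power2_eq_square mult_left_le)
  ultimately show ?thesis by (simp add: sum_eigen_ratio divide_le_eq)
qed

lemma one_minus_eigen_ratio_le:
  assumes "lam i > 0"
  shows "1 - h i \<le> bias_weight (real CARD('d)) (trace (transpose X ** X)) (lam i)"
proof -
  let ?d = "real CARD('d)" and ?t = "sum lam UNIV"
  \<comment> \<open>This is the expectation of the sum of
    \<open>lam k * (g k \<omega>)\<^sup>2\<close> over k: each eigenvalue counts 1/d, and the i-th
    one a further 1 + 1/d.\<close>
  define m where "m = (1 + 1 / ?d) * lam i + ?t / ?d"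
  define g where "g k \<omega> = (\<phi> \<omega> ** transpose (\<phi> \<omega>)) $ k $ i" for k \<omega>
  note g_int = random_projection_outer_diag(1)[OF proj, of i, folded g_def]
    random_projection_outer_square(1)[OF proj, of _ i, folded g_def]
  note g_exp = random_projection_outer_diag(2)[OF proj, of i, folded g_def]
    random_projection_outer_square(2)[OF proj, of _ i, folded g_def]
  have t: "?t \<ge> 0" by (intro sum_nonneg lam_nonneg)
  have "m > 0" unfolding m_def using assms t by (intro add_pos_nonneg mult_pos_pos) auto
  \<comment> \<open>The maximiser of 2 c - c^2 m, with maximal value 1/m.\<close>
  define c where "c = 1 / m"
  \<comment> \<open>The pointwise lower bound \<open>phi_X_diag_lower\<close> scaled by
    \<open>lam i\<close>; it involves only the moments of \<open>g\<close> computed above.\<close>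
  let ?L = "\<lambda>\<omega>. lam i * (2 * c * g i \<omega> - c\<^sup>2 * (\<Sum>k\<in>UNIV. lam k * (g k \<omega>)\<^sup>2))"
  have "(\<Sum>k\<in>UNIV. lam k * (if k = i then 1 + 2 / ?d else 1 / ?d)) =
      (\<Sum>k\<in>UNIV. lam k / ?d + (if k = i then (1 + 1 / ?d) * lam i else 0))"
    by (intro sum.cong) (auto simp: field_simps)
  also have "\<dots> = m" by (simp add: sum.distrib m_def sum_divide_distrib)
  finally have "expectation ?L = lam i * (2 * c - c\<^sup>2 * m)"
    by (simp add: g_int g_exp)
  also have "\<dots> = lam i / m" using \<open>m > 0\<close> by (simp add: c_def power2_eq_square field_simps)
  finally have "lam i / m = expectation ?L" by simp
  also have "\<dots> \<le> h i"
    unfolding eigen_ratio_def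
  proof (rule integral_mono_AE)
    show "integrable M ?L" by (simp add: g_int)
    show "AE \<omega> in M. ?L \<omega> \<le> lam i * phi_X X (\<phi> \<omega>) $ i $ i"
      using AE_nonsingular unfolding g_def
      by eventually_elim (intro mult_left_mono phi_X_diag_lower lam_nonneg)
  qed (rule integrable_ratio)
  finally show ?thesis
    using bias_weight_eq[of ?d "lam i" ?t] assms t by (simp add: trace_gram m_def)
qed

text \<open>Off the diagonal, negating row i preserves the law of the projection but changes the
  sign of the entry, so the expectation equals its own negative.\<close>

lemma scaled_phi_X_expectation:
  "expectation (\<lambda>\<omega>. lam i * lam j * phi_X X (\<phi> \<omega>) $ i $ j) = (if i = j then lam i * h i else 0)"
proof (cases "i = j")
  case True
  then show ?thesis by (simp add: eigen_ratio_def mult.assoc)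
next
  case False
  let ?D = "diag_matrix (\<lambda>k. if k = i then - 1 else 1) :: real^'p^'p"
  let ?f = "\<lambda>\<psi> :: real^'d^'p. lam i * lam j * phi_X X \<psi> $ i $ j"
  have [measurable]: "?f \<in> borel_measurable borel" by measurable
  have "expectation (\<lambda>\<omega>. ?f (\<phi> \<omega>)) = expectation (\<lambda>\<omega>. ?f (?D ** \<phi> \<omega>))"
    using random_projection_expectation[OF proj, of ?f]
      random_projection_expectation[OF random_projection_flip_row[OF proj], of ?f i]
    by (simp only: simp_thms \<open>?f \<in> _\<close>)
  then show ?thesis using False by (simp add: phi_X_flip_row)
qed

end

subsection \<open>The averaged estimator\<close>

text \<open>The strong law for each scaled entry, with \<open>scaled_entry_bound\<close> for
  boundedness and \<open>scaled_phi_X_expectation\<close> for the mean.\<close>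

lemma (in prob_space) AE_average_phi_X:
  fixes \<Phi> :: "nat \<Rightarrow> 'a \<Rightarrow> real^'d^'p"
  assumes "\<And>k. gaussian_compression M X lam (\<Phi> k)"
    and indep: "indep_vars (\<lambda>_. borel) \<Phi> UNIV"
  shows "AE \<omega> in M. (\<lambda>K. (\<Sum>k<K. lam i * lam j * phi_X X (\<Phi> k \<omega>) $ i $ j) / real K) \<longlonglongrightarrow>
    (if i = j then lam i * eigen_ratio M X (\<Phi> 0) lam i else 0)"
proof (rule bounded_strong_law)
  let ?f = "\<lambda>\<psi> :: real^'d^'p. lam i * lam j * phi_X X \<psi> $ i $ j"
  interpret P: gaussian_compression M X lam "\<Phi> k" for k by fact
  have [measurable]: "?f \<in> borel_measurable borel" by measurable
  show "indep_vars (\<lambda>_. borel) (\<lambda>k \<omega>. ?f (\<Phi> k \<omega>)) UNIV"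
    using indep by (rule indep_vars_compose2[where Y = "\<lambda>_. ?f"]) simp
  show "AE \<omega> in M. ?f (\<Phi> k \<omega>) \<in> {- (1 + lam i * lam j)..1 + lam i * lam j}" for k
    using P.AE_nonsingular[of k]
  proof eventually_elim
    case (elim \<omega>)
    then show ?case using P.scaled_entry_bound[of "\<Phi> k \<omega>" i j] by (auto simp: abs_le_iff)
  qed
  \<comment> \<open>All projections share one law, so the one with index 0 can stand for every
    k.\<close>
  have "expectation (\<lambda>\<omega>. ?f (\<Phi> k \<omega>)) = expectation (\<lambda>\<omega>. ?f (\<Phi> 0 \<omega>))" for k
    using random_projection_expectation[OF P.proj[of k], of ?f]
      random_projection_expectation[OF P.proj[of 0], of ?f] by (simp only: simp_thms \<open>?f \<in> _\<close>)
  then show "expectation (\<lambda>\<omega>. ?f (\<Phi> k \<omega>)) = (if i = j then lam i * eigen_ratio M X (\<Phi> 0) lam i else 0)" for k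
    by (simp only: P.scaled_phi_X_expectation[of i j 0])
qed

text \<open>Division by \<open>lam i = 0\<close> is harmless below, since then the \<open>i\<close>-th column of \<open>X\<close> vanishes.\<close>

lemma (in diagonal_gram) averaged_fit_tendsto:
  fixes \<phi> :: "nat \<Rightarrow> real^'d^'p"
  assumes nonsing: "\<And>k. det (compressed_gram X (\<phi> k)) \<noteq> 0"
    and lim: "\<And>i j. (\<lambda>K. (\<Sum>k<K. lam i * lam j * phi_X X (\<phi> k) $ i $ j) / real K) \<longlonglongrightarrow>
      (if i = j then lam i * h i else 0)"
  shows "(\<lambda>K. X *v averaged_compressed_ls X \<phi> K Y) \<longlonglongrightarrow> X *v (\<chi> i. h i / lam i * (column i X \<bullet> Y))"
  unfolding matrix_mult_sum scalar_mult_eq_scaleR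
proof (intro tendsto_sum)
  fix i
  show "(\<lambda>K. averaged_compressed_ls X \<phi> K Y $ i *\<^sub>R column i X) \<longlonglongrightarrow>
      (\<chi> i. h i / lam i * (column i X \<bullet> Y)) $ i *\<^sub>R column i X"
  proof (cases "lam i = 0")
    case True
    then show ?thesis by (simp add: column_eq_0)
  next
    case False
    define S where "S i j K = (\<Sum>k<K. lam i * lam j * phi_X X (\<phi> k) $ i $ j) / real K" for i j K
    have XY: "(transpose X *v Y) $ j = column j X \<bullet> Y" for j
      by (simp add: matrix_vector_mult_def transpose_def column_def inner_vec_def del: transpose_matrix_vector)
    \<comment> \<open>The coordinate is rewritten through the averages \<open>S i j K\<close>, whose
      limits are given. A summand with \<open>lam j = 0\<close> is 0 on both sides because column j
      is zero.\<close>
    have "averaged_compressed_ls X \<phi> K Y $ i = (\<Sum>j\<in>UNIV. (column j X \<bullet> Y) / (lam i * lam j) * S i j K)" for K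
    proof -
      have "averaged_compressed_ls X \<phi> K Y $ i =
          (\<Sum>k<K. \<Sum>j\<in>UNIV. phi_X X (\<phi> k) $ i $ j * (column j X \<bullet> Y)) / real K"
        by (simp add: averaged_compressed_ls_def compressed_ls_eq[OF nonsing] matrix_vector_mult_def[of "phi_X _ _"] XY
            del: transpose_matrix_vector)
      also have "\<dots> = (\<Sum>j\<in>UNIV. (\<Sum>k<K. phi_X X (\<phi> k) $ i $ j * (column j X \<bullet> Y)) / real K)"
        by (subst sum.swap) (simp add: sum_divide_distrib)
      also have "\<dots> = (\<Sum>j\<in>UNIV. (column j X \<bullet> Y) / (lam i * lam j) * S i j K)"
      proof (intro sum.cong refl)
        fix j
        show "(\<Sum>k<K. phi_X X (\<phi> k) $ i $ j * (column j X \<bullet> Y)) / real K = (column j X \<bullet> Y) / (lam i * lam j) * S i j K"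
          using False by (cases "lam j = 0")
            (simp_all add: S_def column_eq_0 sum_distrib_left sum_distrib_right sum_divide_distrib field_simps)
      qed
      finally show ?thesis .
    qed
    moreover have "(\<lambda>K. \<Sum>j\<in>UNIV. (column j X \<bullet> Y) / (lam i * lam j) * S i j K) \<longlonglongrightarrow>
        (\<Sum>j\<in>UNIV. (column j X \<bullet> Y) / (lam i * lam j) * (if i = j then lam i * h i else 0))"
      unfolding S_def by (intro tendsto_sum tendsto_mult tendsto_const lim)
    moreover have "(\<Sum>j\<in>UNIV. (column j X \<bullet> Y) / (lam i * lam j) * (if i = j then lam i * h i else 0)) =
        h i / lam i * (column i X \<bullet> Y)"
      using False by (simp add: if_distrib[where f = "\<lambda>x. _ * x"] cong: if_cong)
    ultimately have "(\<lambda>K. averaged_compressed_ls X \<phi> K Y $ i) \<longlonglongrightarrow> h i / lam i * (column i X \<bullet> Y)"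
      by simp
    then show ?thesis by (simp add: tendsto_scaleR)
  qed
qed

text \<open>The limit shrinks the signal in coordinate i by the factor \<open>h i\<close>, which
  leaves a deterministic bias and a term linear in the noise. Where \<open>lam i = 0\<close> the
  weight removes both.\<close>

lemma (in diagonal_gram) norm_shrunken_residual:
  "(norm (X *v \<beta> - X *v (\<chi> i. h i / lam i * (column i X \<bullet> (X *v \<beta> + e)))))\<^sup>2 =
    (\<Sum>i\<in>UNIV. lam i * (\<beta> $ i * (1 - h i) - h i / lam i * (column i X \<bullet> e))\<^sup>2)"
proof -
  have X\<beta>: "column i X \<bullet> (X *v \<beta>) = lam i * \<beta> $ i" for i
    by (simp add: matrix_mult_sum scalar_mult_eq_scaleR inner_sum_right column_inner
        if_distrib[where f = "\<lambda>x. _ * x"] cong: if_cong)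
  have "(norm (X *v \<beta> - X *v (\<chi> i. h i / lam i * (column i X \<bullet> (X *v \<beta> + e)))))\<^sup>2 =
      (\<Sum>i\<in>UNIV. lam i * (\<beta> $ i - h i / lam i * (lam i * \<beta> $ i + column i X \<bullet> e))\<^sup>2)"
    unfolding matrix_vector_mult_diff_distrib[symmetric] norm_mult_vec by (simp add: inner_add_right X\<beta>)
  also have "\<dots> = (\<Sum>i\<in>UNIV. lam i * (\<beta> $ i * (1 - h i) - h i / lam i * (column i X \<bullet> e))\<^sup>2)"
  proof (intro sum.cong refl)
    fix i
    show "lam i * (\<beta> $ i - h i / lam i * (lam i * \<beta> $ i + column i X \<bullet> e))\<^sup>2 =
        lam i * (\<beta> $ i * (1 - h i) - h i / lam i * (column i X \<bullet> e))\<^sup>2"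
      by (cases "lam i = 0") (simp_all add: algebra_simps)
  qed
  finally show ?thesis .
qed

text \<open>Bounded linear maps commute with Bochner integrals. The second moment is the quadratic
  form of the covariance matrix, expanded entry by entry.\<close>

lemma iid_noise_moments:
  fixes \<epsilon> :: "'w \<Rightarrow> real^'n"
  assumes "iid_noise M \<sigma> \<epsilon>"
  shows "has_bochner_integral M (\<lambda>\<omega>. v \<bullet> \<epsilon> \<omega>) 0"
    and "has_bochner_integral M (\<lambda>\<omega>. (v \<bullet> \<epsilon> \<omega>)\<^sup>2) (\<sigma>\<^sup>2 * (v \<bullet> v))"
proof -
  have "has_bochner_integral M \<epsilon> 0" using assms by (simp add: iid_noise_def)
  from has_bochner_integral_inner_right[OF this, of v]
  show "has_bochner_integral M (\<lambda>\<omega>. v \<bullet> \<epsilon> \<omega>) 0" by simp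
  have "has_bochner_integral M (\<lambda>\<omega>. (\<chi> i j. \<epsilon> \<omega> $ i * \<epsilon> \<omega> $ j) :: real^'n^'n) (mat (\<sigma>\<^sup>2))"
    using assms by (simp add: iid_noise_def)
  from has_bochner_integral_bounded_linear[OF bounded_linear_compose[OF bounded_linear_vec_nth bounded_linear_vec_nth] this]
  have "has_bochner_integral M (\<lambda>\<omega>. \<epsilon> \<omega> $ i * \<epsilon> \<omega> $ j) (if i = j then \<sigma>\<^sup>2 else 0)" for i j
    by (simp add: mat_def)
  then have "has_bochner_integral M (\<lambda>\<omega>. \<Sum>i\<in>UNIV. \<Sum>j\<in>UNIV. v $ i * v $ j * (\<epsilon> \<omega> $ i * \<epsilon> \<omega> $ j))
      (\<Sum>i\<in>UNIV. \<Sum>j\<in>UNIV. v $ i * v $ j * (if i = j then \<sigma>\<^sup>2 else 0))"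
    by (intro has_bochner_integral_sum has_bochner_integral_mult_right)
  moreover have "(\<Sum>i\<in>UNIV. \<Sum>j\<in>UNIV. v $ i * v $ j * (\<epsilon> \<omega> $ i * \<epsilon> \<omega> $ j)) = (v \<bullet> \<epsilon> \<omega>)\<^sup>2" for \<omega>
    by (simp add: inner_vec_def power2_eq_square sum_product mult_ac)
  moreover have "(\<Sum>i\<in>UNIV. \<Sum>j\<in>UNIV. v $ i * v $ j * (if i = j then \<sigma>\<^sup>2 else 0)) = \<sigma>\<^sup>2 * (v \<bullet> v)"
    by (simp add: inner_vec_def sum_distrib_left if_distrib[where f = "\<lambda>x. _ * x"] mult_ac cong: if_cong)
  ultimately show "has_bochner_integral M (\<lambda>\<omega>. (v \<bullet> \<epsilon> \<omega>)\<^sup>2) (\<sigma>\<^sup>2 * (v \<bullet> v))" by simp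
qed

text \<open>After expanding the squares the cross terms have mean 0, and column i paired with the
  noise has variance \<sigma>^2 \<open>lam i\<close>, which leaves \<sigma>^2 h_i^2. Where
  \<open>lam i = 0\<close> the summand is zero, and \<open>h0\<close> makes the right-hand side
  agree.\<close>

lemma (in diagonal_gram) nn_integral_shrunken_residual:
  fixes \<epsilon> :: "'w \<Rightarrow> real^'n"
  assumes "prob_space M" and "iid_noise M \<sigma> \<epsilon>" and h0: "\<And>i. lam i = 0 \<Longrightarrow> h i = 0"
  shows "(\<integral>\<^sup>+ \<omega>. ennreal (\<Sum>i\<in>UNIV. lam i * (\<beta> $ i * (1 - h i) - h i / lam i * (column i X \<bullet> \<epsilon> \<omega>))\<^sup>2) \<partial>M) =
    ennreal (\<sigma>\<^sup>2 * (\<Sum>i\<in>UNIV. (h i)\<^sup>2) + (\<Sum>i\<in>UNIV. (\<beta> $ i)\<^sup>2 * lam i * (1 - h i)\<^sup>2))"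
proof -
  interpret prob_space M by fact
  let ?Z = "\<lambda>i \<omega>. column i X \<bullet> \<epsilon> \<omega>"
  have Z: "has_bochner_integral M (?Z i) 0" "has_bochner_integral M (\<lambda>\<omega>. (?Z i \<omega>)\<^sup>2) (\<sigma>\<^sup>2 * lam i)" for i
    using iid_noise_moments[OF assms(2), of "column i X"] by (simp_all add: column_inner)
  have summand: "has_bochner_integral M (\<lambda>\<omega>. lam i * (\<beta> $ i * (1 - h i) - h i / lam i * ?Z i \<omega>)\<^sup>2)
      (\<sigma>\<^sup>2 * (h i)\<^sup>2 + (\<beta> $ i)\<^sup>2 * lam i * (1 - h i)\<^sup>2)" for i
  proof -
    let ?a = "\<beta> $ i * (1 - h i)" and ?b = "h i / lam i"
    have "has_bochner_integral M (\<lambda>\<omega>. lam i * ?a\<^sup>2 - 2 * lam i * ?a * ?b * ?Z i \<omega> + lam i * ?b\<^sup>2 * (?Z i \<omega>)\<^sup>2)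
        (lam i * ?a\<^sup>2 - 2 * lam i * ?a * ?b * 0 + lam i * ?b\<^sup>2 * (\<sigma>\<^sup>2 * lam i))"
      by (intro has_bochner_integral_add has_bochner_integral_diff has_bochner_integral_mult_right Z)
        (auto simp: has_bochner_integral_iff prob_space)
    moreover have "l * a\<^sup>2 - 2 * l * a * b * z + l * b\<^sup>2 * z\<^sup>2 = l * (a - b * z)\<^sup>2" for l a b z :: real
      by (simp add: power2_eq_square algebra_simps)
    moreover have "lam i * ?a\<^sup>2 - 2 * lam i * ?a * ?b * 0 + lam i * ?b\<^sup>2 * (\<sigma>\<^sup>2 * lam i) =
        \<sigma>\<^sup>2 * (h i)\<^sup>2 + (\<beta> $ i)\<^sup>2 * lam i * (1 - h i)\<^sup>2"
      using h0[of i] by (cases "lam i = 0") (simp_all add: power_divide power_mult_distrib power2_eq_square)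
    ultimately show ?thesis by (simp only:)
  qed
  have sum: "has_bochner_integral M (\<lambda>\<omega>. \<Sum>i\<in>UNIV. lam i * (\<beta> $ i * (1 - h i) - h i / lam i * ?Z i \<omega>)\<^sup>2)
      (\<sigma>\<^sup>2 * (\<Sum>i\<in>UNIV. (h i)\<^sup>2) + (\<Sum>i\<in>UNIV. (\<beta> $ i)\<^sup>2 * lam i * (1 - h i)\<^sup>2))"
    using has_bochner_integral_sum[of UNIV, OF summand] by (simp add: sum.distrib sum_distrib_left)
  show ?thesis
    by (subst nn_integral_eq_integral)
      (use sum in \<open>auto simp: has_bochner_integral_iff intro!: AE_I2 sum_nonneg mult_nonneg_nonneg lam_nonneg\<close>)
qed

theorem theorem4:
  fixes M :: "'w measure"
    and X :: "real^'p^'n"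
    and \<beta> :: "real^'p"
    and \<sigma> :: real
    and lam :: "'p \<Rightarrow> real"
    and \<epsilon> :: "'w \<Rightarrow> real^'n"
    and \<Phi> :: "nat \<Rightarrow> 'w \<Rightarrow> real^'d^'p"
  assumes "prob_space M"
    and "transpose X ** X = diag_matrix lam"
    and "rank X \<ge> CARD('d)"
    and "iid_noise M \<sigma> \<epsilon>"
    and "\<And>k. random_projection M (\<Phi> k)"
    and "prob_space.indep_vars M (\<lambda>_. borel) \<Phi> UNIV"
    and "independent_rvs M (PiM UNIV (\<lambda>_. borel)) (\<lambda>\<omega> k. \<Phi> k \<omega>) borel \<epsilon>"
  defines "\<tau> \<equiv> \<Sum>i\<in>UNIV. (eigen_ratio M X (\<Phi> 0) lam i)\<^sup>2"
    and "w \<equiv> \<lambda>i. bias_weight (real CARD('d)) (trace (transpose X ** X)) (lam i)"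
  shows "(AE \<omega> in M. convergent (\<lambda>K.
            X *v averaged_compressed_ls X (\<lambda>k. \<Phi> k \<omega>) K (X *v \<beta> + \<epsilon> \<omega>))) \<and>
         limit_mse M X \<beta> \<Phi> \<epsilon> \<le> ennreal (\<sigma>\<^sup>2 * \<tau> + (\<Sum>i\<in>UNIV. (\<beta> $ i)\<^sup>2 * lam i * (w i)\<^sup>2)) \<and>
         \<tau> \<in> {(real CARD('d))\<^sup>2 / real CARD('p) .. real CARD('d)}"
proof (intro conjI)
  interpret prob_space M by fact
  have compression: "gaussian_compression M X lam (\<Phi> k)" for k
    using assms(1-3,5) by (simp add: gaussian_compression_def gaussian_compression_axioms_def diagonal_gram_def)
  interpret P: gaussian_compression M X lam "\<Phi> k" for k by (rule compression)
  define h where "h = eigen_ratio M X (\<Phi> 0) lam"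
  \<comment> \<open>A property of the projections alone, so one exceptional null set serves every
    response vector at once.\<close>
  define good where "good \<phi> \<longleftrightarrow> (\<forall>k. det (compressed_gram X (\<phi> k)) \<noteq> 0) \<and>
      (\<forall>i j. (\<lambda>K. (\<Sum>k<K. lam i * lam j * phi_X X (\<phi> k) $ i $ j) / real K) \<longlonglongrightarrow>
        (if i = j then lam i * h i else 0))" for \<phi> :: "nat \<Rightarrow> real^'d^'p"
  have good_lim: "(\<lambda>K. X *v averaged_compressed_ls X \<phi> K Y) \<longlonglongrightarrow> X *v (\<chi> i. h i / lam i * (column i X \<bullet> Y))"
    if "good \<phi>" for \<phi> Y
    using that unfolding good_def by (intro P.averaged_fit_tendsto) auto
  have AE_good: "AE \<omega> in M. good (\<lambda>k. \<Phi> k \<omega>)"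
    unfolding good_def h_def using P.AE_nonsingular AE_average_phi_X[OF compression assms(6)]
    by (simp add: AE_conj_iff AE_all_countable)
  show "AE \<omega> in M. convergent (\<lambda>K. X *v averaged_compressed_ls X (\<lambda>k. \<Phi> k \<omega>) K (X *v \<beta> + \<epsilon> \<omega>))"
    using AE_good by eventually_elim (auto simp: convergent_def intro: good_lim)
  show "\<tau> \<in> {(real CARD('d))\<^sup>2 / real CARD('p) .. real CARD('d)}"
    unfolding \<tau>_def by (rule P.sum_square_eigen_ratio)

  have [measurable]: "\<epsilon> \<in> borel_measurable M"
    using assms(4) by (auto simp: iid_noise_def has_bochner_integral_iff)
  have \<Phi>_meas: "(\<lambda>\<omega> k. \<Phi> k \<omega>) \<in> measurable M (PiM UNIV (\<lambda>_. borel))"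
    by (rule measurable_PiM_single') auto
  let ?bound = "\<sigma>\<^sup>2 * \<tau> + (\<Sum>i\<in>UNIV. (\<beta> $ i)\<^sup>2 * lam i * (w i)\<^sup>2)"
  have inner: "(\<integral>\<^sup>+ e. ennreal ((norm (X *v \<beta> - limit_fit X \<phi> (X *v \<beta> + e)))\<^sup>2) \<partial>distr M borel \<epsilon>) \<le> ennreal ?bound"
    if "good \<phi>" for \<phi>
  proof -
    have "limit_fit X \<phi> Y = X *v (\<chi> i. h i / lam i * (column i X \<bullet> Y))" for Y
      unfolding limit_fit_def using good_lim[OF that] by (rule limI)
    then have "(\<integral>\<^sup>+ e. ennreal ((norm (X *v \<beta> - limit_fit X \<phi> (X *v \<beta> + e)))\<^sup>2) \<partial>distr M borel \<epsilon>) =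
        (\<integral>\<^sup>+ e. ennreal (\<Sum>i\<in>UNIV. lam i * (\<beta> $ i * (1 - h i) - h i / lam i * (column i X \<bullet> e))\<^sup>2)
          \<partial>distr M borel \<epsilon>)"
      by (simp only: P.norm_shrunken_residual)
    also have "\<dots> =
        (\<integral>\<^sup>+ \<omega>. ennreal (\<Sum>i\<in>UNIV. lam i * (\<beta> $ i * (1 - h i) - h i / lam i * (column i X \<bullet> \<epsilon> \<omega>))\<^sup>2) \<partial>M)"
      by (rule nn_integral_distr) measurable
    \<comment> \<open>Up to here the error is exact; an inequality enters only when 1 - h_i is
      replaced by w_i.\<close>
    also have "\<dots> = ennreal (\<sigma>\<^sup>2 * \<tau> + (\<Sum>i\<in>UNIV. (\<beta> $ i)\<^sup>2 * lam i * (1 - h i)\<^sup>2))"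
      unfolding \<tau>_def h_def using assms(1,4)
      by (rule P.nn_integral_shrunken_residual) (simp add: eigen_ratio_def)
    also have "\<dots> \<le> ennreal ?bound"
    proof (intro ennreal_leI add_left_mono sum_mono)
      fix i
      show "(\<beta> $ i)\<^sup>2 * lam i * (1 - h i)\<^sup>2 \<le> (\<beta> $ i)\<^sup>2 * lam i * (w i)\<^sup>2"
      \<comment> \<open>A zero eigenvalue makes both sides vanish. Otherwise 1 - h_i \<le> w_i can
        be squared because 1 - h_i is nonnegative.\<close>
      proof (cases "lam i = 0")
        case False
        then have "1 - h i \<le> w i"
          using P.one_minus_eigen_ratio_le[of i 0] P.lam_nonneg[of i] by (simp add: w_def h_def)
        moreover have "0 \<le> 1 - h i"
          using P.eigen_ratio_bounds[of 0 i] by (simp add: h_def)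
        ultimately show ?thesis
          by (intro mult_left_mono power_mono mult_nonneg_nonneg P.lam_nonneg) auto
      qed simp
    qed
    finally show ?thesis .
  qed
  \<comment> \<open>Measurability of the good set lets the almost sure statement pass from
    \<open>M\<close> to the law of the sequence, over which \<open>limit_mse\<close>
    integrates.\<close>
  have meas: "{\<phi> \<in> space (PiM UNIV (\<lambda>_. borel)). good \<phi>} \<in> sets (PiM UNIV (\<lambda>_. borel))"
  proof -
    have [measurable]: "(\<lambda>\<phi>::real^'d^'p. det (compressed_gram X \<phi>)) \<in> borel_measurable borel"
      unfolding compressed_gram_def by (intro borel_measurable_det) measurable
    show ?thesis unfolding good_def by measurable
  qed
  interpret D: prob_space "distr M (PiM UNIV (\<lambda>_. borel)) (\<lambda>\<omega> k. \<Phi> k \<omega>)"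
    by (rule prob_space_distr[OF \<Phi>_meas])
  have "AE \<phi> in distr M (PiM UNIV (\<lambda>_. borel)) (\<lambda>\<omega> k. \<Phi> k \<omega>). good \<phi>"
    using AE_good by (subst AE_distr_iff[OF \<Phi>_meas meas])
  then have "limit_mse M X \<beta> \<Phi> \<epsilon> \<le> (\<integral>\<^sup>+ \<phi>. ennreal ?bound \<partial>distr M (PiM UNIV (\<lambda>_. borel)) (\<lambda>\<omega> k. \<Phi> k \<omega>))"
    unfolding limit_mse_def by (intro nn_integral_mono_AE) (auto elim!: eventually_mono intro: inner)
  also have "\<dots> = ennreal ?bound" using D.emeasure_space_1 by simp
  finally show "limit_mse M X \<beta> \<Phi> \<epsilon> \<le> ennreal ?bound" .
qed

end
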